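(* Let $B$ satisfy the standing assumptions below. For every $\xi_0\in\mathcal{M}$ there is $T_R>0$, depending only on $|\xi_0|_{\mathcal{M}}$, such that there exists a unique solution $\xi\in C([0,T_R];\mathcal{M})$ of the flow equation $$\xi_t=\varphi^{t,B(\xi)}_\sharp\xi_0,\qquad t\in[0,T_R].$$
   Context: $\mathcal{M}$ is the dual of $C_b(\mathbb{R}^d;\mathbb{R}^d)$ (bounded continuous vector fields, sup norm $\|\cdot\|_\infty$) with dual norm $|\xi|_{\mathcal{M}}=\sup_{\|\theta\|_\infty\le1}|\xi(\theta)|$. Weak norm: $\|\xi\|=\sup\{\xi(\theta):\|\theta\|_\infty+\mathrm{Lip}(\theta)\le1\}$; $\mathcal{M}_w$ is $\mathcal{M}$ with metric $d(\xi,\xi')=\|\xi-\xi'\|$. Standing assumptions: $B:\mathcal{M}_w\to C_b^2(\mathbb{R}^d,\mathbb{R}^d)$ is continuous and there is $C_B>0$ with, for all $\xi,\xi'$: $\|B(\xi)\|_{C_b^2}\le C_B(\|\xi\|+1)$, $\|B(\xi)-B(\xi')\|_\infty\le C_B\|\xi-\xi'\|$, $\|DB(\xi)-DB(\xi')\|_\infty\le C_B\|\xi-\xi'\|$ ($D$ the spatial derivative). For a time-dependent current $\xi$, $\varphi^{t,B(\xi)}$ is the flow of $\frac{dx_t}{dt}=B(\xi_t)(x_t)$ with $\varphi^{0,B(\xi)}=\mathrm{id}$. Push-forward: for a $C^1$ map $\varphi$, $(\varphi_\sharp\theta)(x)=D\varphi(x)^T\theta(\varphi(x))$ and $(\varp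hi_\sharp\xi)(\theta)=\xi(\varphi_\sharp\theta)$.
   Formalization: Continuity of the solution in time is taken in the weak metric (C([0,T_R]; M_w)) instead of the dual norm of M, since norm continuity fails, e.g. for a Dirac current transported by a constant field B; uniqueness holds among all weakly continuous solutions. *)

theory Defs
  imports "HOL-Analysis.Analysis"
begin

type_synonym 'a field = "'a \<Rightarrow> 'a"
type_synonym 'a current = "'a field \<Rightarrow> real"

definition supn :: "('a \<Rightarrow> 'b::real_normed_vector) \<Rightarrow> real" where
  "supn f = (SUP x. norm (f x))"

definition Cb :: "('a::euclidean_space) field \<Rightarrow> bool" where
  "Cb \<theta> \<longleftrightarrow> continuous_on UNIV \<theta> \<and> bounded (range \<theta>)"

text \<open>The dual M of C_b: bounded linear functionals on C_b, normalised to be 0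
  outside C_b so that equality of currents is equality as elements of the dual.\<close>
definition Mspace :: "('a::euclidean_space) current set" where
  "Mspace = {\<xi>. (\<forall>\<theta> \<eta>. Cb \<theta> \<longrightarrow> Cb \<eta> \<longrightarrow> \<xi> (\<lambda>x. \<theta> x + \<eta> x) = \<xi> \<theta> + \<xi> \<eta>)
              \<and> (\<forall>c \<theta>. Cb \<theta> \<longrightarrow> \<xi> (\<lambda>x. c *\<^sub>R \<theta> x) = c * \<xi> \<theta>)
              \<and> (\<exists>K. \<forall>\<theta>. Cb \<theta> \<longrightarrow> \<bar>\<xi> \<theta>\<bar> \<le> K * supn \<theta>)
              \<and> (\<forall>\<theta>. \<not> Cb \<theta> \<longrightarrow> \<xi> \<theta> = 0)}"

definition Mnorm :: "('a::euclidean_space) current \<Rightarrow> real" where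
  "Mnorm \<xi> = Sup {\<bar>\<xi> \<theta>\<bar> | \<theta>. Cb \<theta> \<and> supn \<theta> \<le> 1}"

definition Lip :: "('a::euclidean_space) field \<Rightarrow> real" where
  "Lip \<theta> = Inf {L. lipschitz_on L UNIV \<theta>}"

definition wnorm :: "('a::euclidean_space) current \<Rightarrow> real" where
  "wnorm \<xi> = Sup {\<xi> \<theta> | \<theta>. Cb \<theta> \<and> (\<exists>L. lipschitz_on L UNIV \<theta>) \<and> supn \<theta> + Lip \<theta> \<le> 1}"

definition Dx :: "('a::euclidean_space) field \<Rightarrow> 'a \<Rightarrow> ('a \<Rightarrow>\<^sub>L 'a)" where
  "Dx f x = Blinfun (frechet_derivative f (at x))"

definition D2x :: "('a::euclidean_space) field \<Rightarrow> 'a \<Rightarrow> ('a \<Rightarrow>\<^sub>L ('a \<Rightarrow>\<^sub>L 'a))" where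
  "D2x f x = Blinfun (frechet_derivative (Dx f) (at x))"

definition C2b :: "('a::euclidean_space) field \<Rightarrow> bool" where
  "C2b f \<longleftrightarrow> (\<forall>x. f differentiable (at x)) \<and> (\<forall>x. Dx f differentiable (at x))
     \<and> continuous_on UNIV (D2x f)
     \<and> bounded (range f) \<and> bounded (range (Dx f)) \<and> bounded (range (D2x f))"

definition C2norm :: "('a::euclidean_space) field \<Rightarrow> real" where
  "C2norm f = supn f + supn (Dx f) + supn (D2x f)"

definition standing_assumptions ::
  "(('a::euclidean_space) current \<Rightarrow> 'a field) \<Rightarrow> real \<Rightarrow> bool" where
  "standing_assumptions B CB \<longleftrightarrow> CB > 0
     \<and> (\<forall>\<xi>\<in>Mspace. C2b (B \<xi>))
     \<and> (\<forall>\<xi>\<in>Mspace. \<forall>e>0. \<exists>\<delta>>0. \<forall>\<xi>'\<in>Mspace.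
            wnorm (\<lambda>\<theta>. \<xi>' \<theta> - \<xi> \<theta>) < \<delta> \<longrightarrow> C2norm (\<lambda>x. B \<xi>' x - B \<xi> x) < e)
     \<and> (\<forall>\<xi>\<in>Mspace. C2norm (B \<xi>) \<le> CB * (wnorm \<xi> + 1))
     \<and> (\<forall>\<xi>\<in>Mspace. \<forall>\<xi>'\<in>Mspace. supn (\<lambda>x. B \<xi> x - B \<xi>' x) \<le> CB * wnorm (\<lambda>\<theta>. \<xi> \<theta> - \<xi>' \<theta>))
     \<and> (\<forall>\<xi>\<in>Mspace. \<forall>\<xi>'\<in>Mspace.
            supn (\<lambda>x. Dx (B \<xi>) x - Dx (B \<xi>') x) \<le> CB * wnorm (\<lambda>\<theta>. \<xi> \<theta> - \<xi>' \<theta>))"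

definition is_flow ::
  "(('a::euclidean_space) current \<Rightarrow> 'a field) \<Rightarrow> (real \<Rightarrow> 'a current) \<Rightarrow> real
    \<Rightarrow> (real \<Rightarrow> 'a \<Rightarrow> 'a) \<Rightarrow> bool" where
  "is_flow B \<xi> T \<phi> \<longleftrightarrow> (\<forall>x. \<phi> 0 x = x \<and>
     (\<forall>t\<in>{0..T}. ((\<lambda>s. \<phi> s x) has_vector_derivative B (\<xi> t) (\<phi> t x)) (at t within {0..T})))"

definition push_field :: "('a::euclidean_space \<Rightarrow> 'a) \<Rightarrow> 'a field \<Rightarrow> 'a field" where
  "push_field \<phi> \<theta> = (\<lambda>x. adjoint (frechet_derivative \<phi> (at x)) (\<theta> (\<phi> x)))"

definition push_current :: "('a::euclidean_space \<Rightarrow> 'a) \<Rightarrow> 'a current \<Rightarrow> 'a current" where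
  "push_current \<phi> \<xi> = (\<lambda>\<theta>. if Cb \<theta> then \<xi> (push_field \<phi> \<theta>) else 0)"

definition is_solution ::
  "(('a::euclidean_space) current \<Rightarrow> 'a field) \<Rightarrow> 'a current \<Rightarrow> real
    \<Rightarrow> (real \<Rightarrow> 'a current) \<Rightarrow> bool" where
  "is_solution B \<xi>0 T \<xi> \<longleftrightarrow>
     (\<forall>t\<in>{0..T}. \<xi> t \<in> Mspace)
     \<and> (\<forall>t\<in>{0..T}. \<forall>e>0. \<exists>\<delta>>0. \<forall>s\<in>{0..T}. \<bar>s - t\<bar> < \<delta> \<longrightarrow> wnorm (\<lambda>\<theta>. \<xi> s \<theta> - \<xi> t \<theta>) < e)
     \<and> (\<exists>\<phi>. is_flow B \<xi> T \<phi> \<and> (\<forall>t\<in>{0..T}. \<xi> t = push_current (\<phi> t) \<xi>0))"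

end

theory Submission
  imports Defs
begin

text \<open>
  The weak norm does not separate points of M, since bounded Lipschitz fields are not dense in
  \<open>C\<^sub>b\<close>; hence the fixed point argument is run on flows rather than on currents. A flow is encoded by the pair \<open>w = (u, J)\<close> of its
  displacement \<open>u = \<phi> - id\<close> and its spatial derivative \<open>J = D\<phi>\<close>, a point of a Banach space of bounded
  continuous functions, and \<open>\<phi>\<close> pushes \<open>\<xi>0\<close> to a current \<open>\<xi>(w)\<close> that is Lipschitz in \<open>w\<close>
  for the weak norm as long as \<open>J\<close> stays bounded. The flow equation becomes the autonomous equation
  \<open>u' = B(\<xi>(w)) \<circ> (id + u)\<close>, \<open>J' = DB(\<xi>(w)) \<circ> (id + u) \<cdot> J\<close>, whose right-hand side is bounded and
  Lipschitz on bounded sets of \<open>J\<close>, with constants depending only on \<open>|\<xi>0|\<close>. Picard iteration and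
  Gronwall's inequality give existence and uniqueness; the bound on the second derivative of \<open>B(\<xi>)\<close>
  ensures that \<open>J\<close> is the derivative of \<open>id + u\<close>. Conversely the flow of any solution yields such a pair.
\<close>

section \<open>Ordinary differential equations in Banach spaces\<close>

lemma has_integral_derivative_prefix:
  fixes e :: "real \<Rightarrow> 'b::banach"
  assumes "\<And>t. t \<in> {0..T} \<Longrightarrow> (e has_vector_derivative e' t) (at t within {0..T})"
    and "t \<in> {0..T}"
  shows "(e' has_integral (e t - e 0)) {0..t}"
proof (rule fundamental_theorem_of_calculus)
  show "(e has_vector_derivative e' s) (at s within {0..t})" if "s \<in> {0..t}" for s
    by (rule has_vector_derivative_within_subset[OF assms(1)]) (use assms(2) that in auto)
qed (use assms in auto)

text \<open>The right-hand side \<open>F\<close> of the bound satisfies F' = K g <= K F, so the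
  integrating factor makes \<open>H\<close> nonincreasing, and H(0) = c.\<close>

lemma gronwall_integral:
  fixes g :: "real \<Rightarrow> real"
  assumes cont: "continuous_on {0..T} g"
    and bound: "\<And>t. t \<in> {0..T} \<Longrightarrow> g t \<le> c + K * integral {0..t} g"
    and K: "K \<ge> 0" and t: "t \<in> {0..T}"
  shows "g t \<le> c * exp (K * t)"
proof -
  define F where "F s = c + K * integral {0..s} g" for s
  define H where "H s = F s * exp (- (K * s))" for s
  have F': "(F has_real_derivative K * g s) (at s within {0..T})" if "s \<in> {0..T}" for s
    unfolding F_def
    using integral_has_real_derivative[OF cont that]
    by (auto intro!: derivative_eq_intros)
  have H': "(H has_real_derivative K * (g s - F s) * exp (- (K * s))) (at s within {0..T})"
    if "s \<in> {0..T}" for s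
    unfolding H_def
    by (auto intro!: derivative_eq_intros F'[OF that] simp: algebra_simps)
  have "((\<lambda>s. K * (g s - F s) * exp (- (K * s))) has_integral (H t - H 0)) {0..t}"
    by (rule has_integral_derivative_prefix[OF H'[unfolded has_real_derivative_iff_has_vector_derivative] t])
  moreover have "K * (g s - F s) * exp (- (K * s)) \<le> 0" if "s \<in> {0..t}" for s
    using bound[of s] that t K
    by (intro mult_nonpos_nonneg[OF mult_nonneg_nonpos]) (auto simp: F_def)
  ultimately have "H t - H 0 \<le> 0"
    using has_integral_le[OF _ has_integral_0, of _ "H t - H 0" "{0..t}"] by blast
  then have "F t * exp (- (K * t)) \<le> c"
    by (simp add: H_def F_def)
  then have "F t \<le> c * exp (K * t)"
    by (simp add: exp_minus field_simps)
  with bound[OF t] show ?thesis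
    by (simp add: F_def)
qed

text \<open>The norm of a curve need not be differentiable, so the bound on \<open>e'\<close> is
  integrated first and the integral inequality is applied to \<open>norm (e t)\<close>. The
  inhomogeneity \<open>a\<close>, integrated over a time of at most T, gives the term
  \<open>a * T\<close>.\<close>

lemma gronwall_norm:
  fixes e :: "real \<Rightarrow> 'b::banach"
  assumes deriv: "\<And>t. t \<in> {0..T} \<Longrightarrow> (e has_vector_derivative e' t) (at t within {0..T})"
    and bound: "\<And>t. t \<in> {0..T} \<Longrightarrow> norm (e' t) \<le> a + K * norm (e t)"
    and nonneg: "a \<ge> 0" "K \<ge> 0" and t: "t \<in> {0..T}"
  shows "norm (e t) \<le> (norm (e 0) + a * T) * exp (K * t)"
proof (rule gronwall_integral[where T = T])
  have cont: "continuous_on {0..T} e"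
    using deriv by (rule continuous_on_vector_derivative)
  then show "continuous_on {0..T} (\<lambda>t. norm (e t))"
    by (intro continuous_intros)
  show "norm (e t) \<le> norm (e 0) + a * T + K * integral {0..t} (\<lambda>t. norm (e t))"
    if t: "t \<in> {0..T}" for t
  proof -
    have cont_t: "continuous_on {0..t} (\<lambda>s. norm (e s))"
      using t by (intro continuous_intros continuous_on_subset[OF cont]) auto
    have int_e: "(\<lambda>s. norm (e s)) integrable_on {0..t}"
      by (rule integrable_continuous_interval[OF cont_t])
    have int: "(e' has_integral (e t - e 0)) {0..t}"
      using deriv t by (rule has_integral_derivative_prefix)
    have "(\<lambda>s. a + K * norm (e s)) integrable_on {0..t}"
      by (intro integrable_continuous_interval continuous_intros cont_t)
    then have "norm (e t - e 0) \<le> integral {0..t} (\<lambda>s. a + K * norm (e s))"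
      using integral_norm_bound_integral[of e' "{0..t}" "\<lambda>s. a + K * norm (e s)"] bound t int
      by (auto simp: integral_unique has_integral_integrable)
    also have "\<dots> = a * t + K * integral {0..t} (\<lambda>s. norm (e s))"
      using t int_e by (subst integral_add) (auto intro: integrable_cmul[where 'b = real, simplified])
    also have "\<dots> \<le> a * T + K * integral {0..t} (\<lambda>s. norm (e s))"
      using t nonneg by (auto intro: mult_left_mono)
    finally show ?thesis
      using norm_triangle_sub[of "e t" "e 0"] by simp
  qed
qed (use assms in auto)

text \<open>Gronwall with zero inhomogeneity and zero initial difference. The Lipschitz estimate is
  asked only along the two curves, so it may come from any set that contains both.\<close>

lemma ode_unique:
  fixes v w :: "real \<Rightarrow> 'b::banach"
  assumes v: "\<And>t. t \<in> {0..T} \<Longrightarrow> (v has_vector_derivative v' t) (at t within {0..T})"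
    and w: "\<And>t. t \<in> {0..T} \<Longrightarrow> (w has_vector_derivative w' t) (at t within {0..T})"
    and lip: "\<And>t. t \<in> {0..T} \<Longrightarrow> norm (v' t - w' t) \<le> L * norm (v t - w t)"
    and "L \<ge> 0" "v 0 = w 0" "t \<in> {0..T}"
  shows "v t = w t"
  using gronwall_norm[of T "\<lambda>t. v t - w t" "\<lambda>t. v' t - w' t" 0 L t] assms
  by (auto intro: has_vector_derivative_diff)

section \<open>Picard iteration in weighted sup norms\<close>

instance bcontfun :: (metric_space, banach) banach ..

lemma integral_exp_weight_le:
  assumes "k > 0" "0 \<le> t"
  shows "integral {0..t} (\<lambda>s. exp (k * s)) \<le> exp (k * t) / (k::real)"
proof -
  have "((\<lambda>s. exp (k * s)) has_integral (exp (k * t) / k - exp (k * 0) / k)) {0..t}"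
    using assms
    by (intro fundamental_theorem_of_calculus)
      (auto intro!: derivative_eq_intros simp flip: has_real_derivative_iff_has_vector_derivative)
  then show ?thesis
    using assms by (auto simp: integral_unique)
qed

lemma continuous_on_lipschitz_compose:
  fixes G :: "real \<Rightarrow> 'b::real_normed_vector \<Rightarrow> 'c::real_normed_vector"
  assumes lip: "\<And>t. t \<in> I \<Longrightarrow> L-lipschitz_on S (G t)"
    and cont: "\<And>x. x \<in> S \<Longrightarrow> continuous_on I (\<lambda>t. G t x)"
    and w: "continuous_on I w" "w ` I \<subseteq> S"
  shows "continuous_on I (\<lambda>t. G t (w t))"
  unfolding continuous_on_def
proof
  fix t assume t: "t \<in> I"
  have "((\<lambda>s. G s (w t)) \<longlongrightarrow> G t (w t)) (at t within I)"
    using cont[of "w t"] w t by (auto simp: continuous_on_def)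
  moreover have "((\<lambda>s. G s (w s) - G s (w t)) \<longlongrightarrow> 0) (at t within I)"
  proof (rule Lim_null_comparison)
    show "\<forall>\<^sub>F s in at t within I. norm (G s (w s) - G s (w t)) \<le> L * norm (w s - w t)"
      unfolding eventually_at_filter
      using lipschitz_onD[OF lip] w t
      by (intro always_eventually) (simp add: dist_norm image_subset_iff)
    have "(w \<longlongrightarrow> w t) (at t within I)"
      using w t by (auto simp: continuous_on_def)
    then show "((\<lambda>s. L * norm (w s - w t)) \<longlongrightarrow> 0) (at t within I)"
      by (auto intro!: tendsto_eq_intros)
  qed
  ultimately show "((\<lambda>s. G s (w s)) \<longlongrightarrow> G t (w t)) (at t within I)"
    using tendsto_add by fastforce
qed

text \<open>The Picard operator is conjugated with the weight \<open>exp (k t)\<close>, \<open>k = 2 L + 1\<close>; this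
  makes it a contraction on intervals of any length.\<close>

lemma ode_exists:
  fixes G :: "real \<Rightarrow> 'b::banach \<Rightarrow> 'b"
  assumes T: "T \<ge> 0" and S: "closed S" "w0 \<in> S"
    and lip: "\<And>t. t \<in> {0..T} \<Longrightarrow> L-lipschitz_on S (G t)"
    and cont: "\<And>x. x \<in> S \<Longrightarrow> continuous_on {0..T} (\<lambda>t. G t x)"
    and inv: "\<And>w t. continuous_on {0..T} w \<Longrightarrow> w ` {0..T} \<subseteq> S \<Longrightarrow> t \<in> {0..T} \<Longrightarrow>
      w0 + integral {0..t} (\<lambda>s. G s (w s)) \<in> S"
  obtains w where "w ` {0..T} \<subseteq> S" "w 0 = w0"
    "\<And>t. t \<in> {0..T} \<Longrightarrow> (w has_vector_derivative G t (w t)) (at t within {0..T})"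
proof -
  have L: "L \<ge> 0"
    using lip[of 0] T by (auto simp: lipschitz_on_def)
  define k where "k = 2 * L + 1"
  have k: "k > 0" "L / k \<le> 1 / 2"
    using L by (auto simp: k_def field_simps)
  \<comment> \<open>The sup norm of \<open>v\<close> is the weighted norm sup exp(-k t) |w(t)| of
    the curve w = \<open>scaled v\<close>.\<close>
  define scaled where "scaled v t = exp (k * t) *\<^sub>R apply_bcontfun v t" for v :: "real \<Rightarrow>\<^sub>C 'b" and t
  define I where "I v t = w0 + integral {0..t} (\<lambda>s. G s (scaled v s))" for v t
  \<comment> \<open>Elements of the function space live on the whole real line; clamping time
    extends a curve on \<open>{0..T}\<close> by its endpoint values.\<close>
  define c where "c t = max 0 (min T t)" for t :: real
  define P where "P v = Bcontfun (\<lambda>t. exp (- (k * c t)) *\<^sub>R I v (c t))" for v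
  define V where "V = {v. \<forall>t\<in>{0..T}. scaled v t \<in> S}"
  have c: "c t \<in> {0..T}" "t \<in> {0..T} \<Longrightarrow> c t = t" for t
    using T by (auto simp: c_def)
  have c_cont: "continuous_on UNIV c"
    unfolding c_def by (intro continuous_intros)
  have scaled_cont: "continuous_on A (scaled v)" for A v
    unfolding scaled_def by (intro continuous_intros) auto
  have G_cont: "continuous_on {0..T} (\<lambda>s. G s (scaled v s))" if "v \<in> V" for v
    by (rule continuous_on_lipschitz_compose[OF lip cont scaled_cont]) (use that in \<open>auto simp: V_def\<close>)
  have I_deriv: "(I v has_vector_derivative G t (scaled v t)) (at t within {0..T})"
    if "v \<in> V" "t \<in> {0..T}" for v t
    unfolding I_def using integral_has_vector_derivative[OF G_cont[OF that(1)] that(2)]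
    by (auto intro!: derivative_eq_intros)
  have I_cont: "continuous_on {0..T} (I v)" if "v \<in> V" for v
    using I_deriv[OF that] by (rule continuous_on_vector_derivative)
  have P_apply: "apply_bcontfun (P v) t = exp (- (k * c t)) *\<^sub>R I v (c t)" if v: "v \<in> V" for v t
  proof -
    define h where "h t = exp (- (k * t)) *\<^sub>R I v t" for t
    have h: "continuous_on {0..T} h"
      unfolding h_def by (intro continuous_intros I_cont v)
    have "bounded (range (\<lambda>t. h (c t)))"
      using compact_imp_bounded[OF compact_continuous_image[OF h compact_Icc]]
      by (rule bounded_subset) (use c in auto)
    moreover have "continuous_on UNIV (\<lambda>t. h (c t))"
      by (rule continuous_on_compose2[OF h c_cont]) (use c in auto)
    ultimately have "(\<lambda>t. h (c t)) \<in> bcontfun"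
      by (auto simp: bcontfun_def)
    then show ?thesis
      by (simp add: P_def h_def Bcontfun_inverse)
  qed
  have scaled_P: "scaled (P v) t = I v t" if "v \<in> V" "t \<in> {0..T}" for v t
    using that c by (simp add: scaled_def P_apply exp_minus)
  have "\<exists>!v. v \<in> V \<and> P v = v"
  proof (rule Banach_fix)
    \<comment> \<open>Membership in \<open>V\<close> is a closed condition imposed at each time
      separately, which makes \<open>V\<close> closed in the sup norm.\<close>
    have "V = PiC {0..T} (\<lambda>t. (\<lambda>x. exp (k * t) *\<^sub>R x) -` S)"
      by (auto simp: V_def scaled_def mem_PiC_iff Pi_iff)
    moreover have "closed ((\<lambda>x. exp (k * t) *\<^sub>R x) -` S)" for t
      by (intro continuous_closed_vimage S(1) continuous_intros)
    ultimately show "complete V"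
      by (simp add: complete_eq_closed closed_PiC)
    \<comment> \<open>The element of \<open>V\<close> exhibited here is the constant curve
      \<open>w0\<close> in weighted form.\<close>
    have "(\<lambda>t. exp (- (k * c t)) *\<^sub>R w0) \<in> bcontfun"
      using k c
      by (intro bcontfun_normI[where b = "norm w0"] continuous_intros c_cont)
        (auto simp: mult_left_le_one_le)
    then have "Bcontfun (\<lambda>t. exp (- (k * c t)) *\<^sub>R w0) \<in> V"
      using S by (auto simp: V_def scaled_def Bcontfun_inverse c exp_minus)
    then show "V \<noteq> {}"
      by blast
    show "P ` V \<subseteq> V"
      using inv[OF scaled_cont] by (auto simp: V_def scaled_P[unfolded V_def] I_def image_subset_iff)
    show "dist (P v) (P v') \<le> 1 / 2 * dist v v'" if v: "v \<in> V" "v' \<in> V" for v v'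
    proof (rule dist_bound)
      fix s
      define t where "t = c s"
      have t: "t \<in> {0..T}"
        using c by (simp add: t_def)
      have int: "(\<lambda>s. G s (scaled v s)) integrable_on {0..t}" if "v \<in> V" for v
        using t by (intro integrable_continuous_interval continuous_on_subset[OF G_cont[OF that]]) auto
      have le: "norm (G r (scaled v r) - G r (scaled v' r)) \<le> (L * dist v v') * exp (k * r)"
        if r: "r \<in> {0..t}" for r
      proof -
        have "norm (G r (scaled v r) - G r (scaled v' r)) \<le> L * dist (scaled v r) (scaled v' r)"
          using lipschitz_onD[OF lip] r t v by (auto simp: V_def dist_norm)
        also have "dist (scaled v r) (scaled v' r) = exp (k * r) * dist (apply_bcontfun v r) (apply_bcontfun v' r)"
          by (simp add: scaled_def dist_norm flip: scaleR_diff_right)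
        also have "L * \<dots> \<le> L * (exp (k * r) * dist v v')"
          by (intro mult_left_mono dist_bounded L) auto
        finally show ?thesis
          by (simp add: ac_simps)
      qed
      have "norm (I v t - I v' t) = norm (integral {0..t} (\<lambda>r. G r (scaled v r) - G r (scaled v' r)))"
        using v by (simp add: I_def integral_diff int)
      also have "\<dots> \<le> integral {0..t} (\<lambda>r. (L * dist v v') * exp (k * r))"
        by (intro integral_norm_bound_integral integrable_diff int v le
            integrable_continuous_interval continuous_intros)
      also have "\<dots> = (L * dist v v') * integral {0..t} (\<lambda>r. exp (k * r))"
        by simp
      also have "\<dots> \<le> (L * dist v v') * (exp (k * t) / k)"
        using L k t by (intro mult_left_mono integral_exp_weight_le) auto
      finally have "exp (- (k * t)) * norm (I v t - I v' t)
          \<le> exp (- (k * t)) * ((L * dist v v') * (exp (k * t) / k))"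
        by (intro mult_left_mono) auto
      also have "\<dots> = L / k * dist v v'"
        by (simp add: exp_minus field_simps)
      also have "\<dots> \<le> 1 / 2 * dist v v'"
        by (intro mult_right_mono k) auto
      finally show "dist (apply_bcontfun (P v) s) (apply_bcontfun (P v') s) \<le> 1 / 2 * dist v v'"
        using v by (simp add: P_apply dist_norm t_def flip: scaleR_diff_right)
    qed
  qed auto
  then obtain v where v: "v \<in> V" "P v = v"
    by blast
  have eq: "scaled v t = I v t" if "t \<in> {0..T}" for t
    using scaled_P[OF v(1) that] v(2) by simp
  show thesis
  proof (rule that[of "scaled v"])
    show "scaled v ` {0..T} \<subseteq> S"
      using v by (auto simp: V_def)
    show "scaled v 0 = w0"
      using eq[of 0] T by (simp add: I_def)
    show "(scaled v has_vector_derivative G t (scaled v t)) (at t within {0..T})" if "t \<in> {0..T}" for t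
      by (rule has_vector_derivative_transform[OF that _ I_deriv[OF v(1) that]]) (simp add: eq)
  qed
qed

section \<open>Currents and the weak norm\<close>

lemma norm_le_supn: "bounded (range f) \<Longrightarrow> norm (f x) \<le> supn f"
  unfolding supn_def by (auto intro!: cSUP_upper bounded_imp_bdd_above simp: bounded_norm_comp)

lemma supn_le: "(\<And>x. norm (f x) \<le> c) \<Longrightarrow> supn f \<le> c"
  unfolding supn_def by (rule cSUP_least) auto

lemma supn_nonneg: "bounded (range f) \<Longrightarrow> 0 \<le> supn f"
  using norm_le_supn[of f undefined] norm_ge_zero order_trans by blast

lemma supn_uminus [simp]: "supn (\<lambda>x. - f x) = supn f"
  by (simp add: supn_def)

lemma CbI: "continuous_on UNIV \<theta> \<Longrightarrow> (\<And>x. norm (\<theta> x) \<le> c) \<Longrightarrow> Cb \<theta>"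
  unfolding Cb_def by (auto intro: boundedI)

lemma Cb_norm_le_supn: "Cb \<theta> \<Longrightarrow> norm (\<theta> x) \<le> supn \<theta>"
  by (simp add: Cb_def norm_le_supn)

lemma Cb_add: "Cb \<theta> \<Longrightarrow> Cb \<eta> \<Longrightarrow> Cb (\<lambda>x. \<theta> x + \<eta> x)"
  unfolding Cb_def by (auto intro!: continuous_intros bounded_plus_comp)

lemma Cb_scaleR: "Cb \<theta> \<Longrightarrow> Cb (\<lambda>x. c *\<^sub>R \<theta> x)"
  unfolding Cb_def by (auto intro!: continuous_intros bounded_scaleR_comp)

lemma Cb_uminus: "Cb \<theta> \<Longrightarrow> Cb (\<lambda>x. - \<theta> x)"
  using Cb_scaleR[of \<theta> "-1"] by simp

lemma Cb_zero: "Cb (\<lambda>x. 0)"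
  unfolding Cb_def by auto

lemma Mspace_add: "\<xi> \<in> Mspace \<Longrightarrow> Cb \<theta> \<Longrightarrow> Cb \<eta> \<Longrightarrow> \<xi> (\<lambda>x. \<theta> x + \<eta> x) = \<xi> \<theta> + \<xi> \<eta>"
  and Mspace_scaleR: "\<xi> \<in> Mspace \<Longrightarrow> Cb \<theta> \<Longrightarrow> \<xi> (\<lambda>x. c *\<^sub>R \<theta> x) = c * \<xi> \<theta>"
  by (auto simp: Mspace_def)

lemma Mspace_uminus: "\<xi> \<in> Mspace \<Longrightarrow> Cb \<theta> \<Longrightarrow> \<xi> (\<lambda>x. - \<theta> x) = - \<xi> \<theta>"
  using Mspace_scaleR[of \<xi> \<theta> "-1"] by simp

lemma Mspace_diff:
  assumes "\<xi> \<in> Mspace" "Cb \<theta>" "Cb \<eta>"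
  shows "\<xi> (\<lambda>x. \<theta> x - \<eta> x) = \<xi> \<theta> - \<xi> \<eta>"
  using Mspace_add[of \<xi> \<theta> "\<lambda>x. - \<eta> x"] assms by (simp add: Mspace_uminus Cb_uminus)

lemma Mspace_zero_field: "\<xi> \<in> Mspace \<Longrightarrow> \<xi> (\<lambda>x. 0) = 0"
  using Mspace_scaleR[of \<xi> "\<lambda>x. 0" 0] Cb_zero by simp

lemma Mspace_minus:
  assumes "\<xi> \<in> Mspace" "\<eta> \<in> Mspace"
  shows "(\<lambda>\<theta>. \<xi> \<theta> - \<eta> \<theta>) \<in> Mspace"
proof -
  obtain K K' where "\<And>\<theta>. Cb \<theta> \<Longrightarrow> \<bar>\<xi> \<theta>\<bar> \<le> K * supn \<theta>" "\<And>\<theta>. Cb \<theta> \<Longrightarrow> \<bar>\<eta> \<theta>\<bar> \<le> K' * supn \<theta>"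
    using assms by (auto simp: Mspace_def)
  then have "\<bar>\<xi> \<theta> - \<eta> \<theta>\<bar> \<le> (K + K') * supn \<theta>" if "Cb \<theta>" for \<theta>
    using abs_triangle_ineq4[of "\<xi> \<theta>" "\<eta> \<theta>"] that by (force simp: distrib_right)
  then have "\<exists>K. \<forall>\<theta>. Cb \<theta> \<longrightarrow> \<bar>\<xi> \<theta> - \<eta> \<theta>\<bar> \<le> K * supn \<theta>"
    by blast
  with assms show ?thesis
    by (simp add: Mspace_def right_diff_distrib)
qed

lemma Mnorm_upper:
  assumes \<xi>: "\<xi> \<in> Mspace" and \<theta>: "Cb \<theta>" "supn \<theta> \<le> 1"
  shows "\<bar>\<xi> \<theta>\<bar> \<le> Mnorm \<xi>"
proof -
  obtain K where K: "\<And>\<theta>. Cb \<theta> \<Longrightarrow> \<bar>\<xi> \<theta>\<bar> \<le> K * supn \<theta>"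
    using \<xi> by (auto simp: Mspace_def)
  \<comment> \<open>The constant \<open>K\<close> may be negative, hence the absolute value in the
    uniform bound.\<close>
  have "\<bar>\<xi> \<eta>\<bar> \<le> \<bar>K\<bar>" if "Cb \<eta>" "supn \<eta> \<le> 1" for \<eta>
  proof -
    have "0 \<le> supn \<eta>"
      using that by (auto simp: Cb_def intro: supn_nonneg)
    then have "K * supn \<eta> \<le> \<bar>K\<bar> * 1"
      using that by (intro mult_mono) auto
    then show ?thesis
      using K[OF that(1)] by simp
  qed
  then have "bdd_above {\<bar>\<xi> \<theta>\<bar> |\<theta>. Cb \<theta> \<and> supn \<theta> \<le> 1}"
    by (auto intro!: bdd_aboveI[where M = "\<bar>K\<bar>"])
  then show ?thesis
    unfolding Mnorm_def using \<theta> by (auto intro: cSup_upper)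
qed

text \<open>Rescaling by 1/c moves the field into the unit ball, and c = 0 forces the zero field.
  Pointwise bounds are the form in which the later estimates of fields arrive.\<close>

lemma Mspace_bound:
  assumes \<xi>: "\<xi> \<in> Mspace" and \<theta>: "Cb \<theta>" "\<And>x. norm (\<theta> x) \<le> c"
  shows "\<bar>\<xi> \<theta>\<bar> \<le> Mnorm \<xi> * c"
proof (cases "c = 0")
  case True
  then have "\<theta> = (\<lambda>x. 0)"
    using \<theta> by auto
  then show ?thesis
    using Mspace_zero_field[OF \<xi>] True by simp
next
  case False
  then have c: "c > 0"
    using \<theta>(2)[of undefined] norm_ge_zero[of "\<theta> undefined"] by linarith
  have "supn (\<lambda>x. inverse c *\<^sub>R \<theta> x) \<le> 1"
    using c \<theta> by (intro supn_le) (auto simp: field_simps)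
  then have "\<bar>\<xi> (\<lambda>x. inverse c *\<^sub>R \<theta> x)\<bar> \<le> Mnorm \<xi>"
    by (intro Mnorm_upper \<xi> Cb_scaleR \<theta>)
  then show ?thesis
    using c Mspace_scaleR[OF \<xi> \<theta>(1)] by (simp add: abs_mult field_simps)
qed

section \<open>The weak norm and its test fields\<close>

definition wtest :: "'a::euclidean_space field \<Rightarrow> bool" where
  "wtest \<theta> \<longleftrightarrow> Cb \<theta> \<and> (\<exists>L. L-lipschitz_on UNIV \<theta>) \<and> supn \<theta> + Lip \<theta> \<le> 1"

lemma wnorm_eq: "wnorm \<xi> = Sup {\<xi> \<theta> |\<theta>. wtest \<theta>}"
  by (simp add: wnorm_def wtest_def)

lemma Lip_nonneg: "\<exists>L. L-lipschitz_on UNIV \<theta> \<Longrightarrow> 0 \<le> Lip \<theta>"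
  unfolding Lip_def by (rule cInf_greatest) (auto simp: lipschitz_on_def)

text \<open>The infimum defining \<open>Lip\<close> is attained: each difference quotient is a lower
  bound of the set of Lipschitz constants, hence at most their infimum.\<close>

lemma lipschitz_on_Lip:
  assumes "\<exists>L. L-lipschitz_on UNIV \<theta>"
  shows "(Lip \<theta>)-lipschitz_on UNIV \<theta>"
proof (rule lipschitz_onI[OF _ Lip_nonneg[OF assms]])
  fix x y
  show "dist (\<theta> x) (\<theta> y) \<le> Lip \<theta> * dist x y"
  proof (cases "x = y")
    case False
    have "dist (\<theta> x) (\<theta> y) / dist x y \<le> Lip \<theta>"
      unfolding Lip_def
      by (rule cInf_greatest) (use assms False in \<open>auto simp: lipschitz_on_def divide_simps\<close>)
    then show ?thesis
      using False by (simp add: field_simps)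
  qed auto
qed

lemma wtest_Cb: "wtest \<theta> \<Longrightarrow> Cb \<theta>"
  by (simp add: wtest_def)

lemma wtest_norm_le: "wtest \<theta> \<Longrightarrow> norm (\<theta> x) \<le> 1"
  using Cb_norm_le_supn[of \<theta> x] Lip_nonneg[of \<theta>] by (auto simp: wtest_def)

lemma wtest_lipschitz:
  assumes "wtest \<theta>"
  shows "norm (\<theta> x - \<theta> y) \<le> norm (x - y)"
proof -
  have "Lip \<theta> \<le> 1"
    using assms supn_nonneg[of \<theta>] by (auto simp: wtest_def Cb_def)
  then have "Lip \<theta> * norm (x - y) \<le> 1 * norm (x - y)"
    by (rule mult_right_mono) auto
  then show ?thesis
    using lipschitz_onD[OF lipschitz_on_Lip, of \<theta> x y] assms by (auto simp: wtest_def dist_norm)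
qed

lemma wtest_uminus: "wtest \<theta> \<Longrightarrow> wtest (\<lambda>x. - \<theta> x)"
  by (auto simp: wtest_def Cb_uminus Lip_def)

lemma wtest_zero: "wtest (\<lambda>x. 0)"
proof -
  have "Lip (\<lambda>x::'a. 0) \<le> 0"
    unfolding Lip_def by (rule cInf_lower) (auto simp: lipschitz_on_def intro!: bdd_belowI[where m = 0])
  then show ?thesis
    by (auto simp: wtest_def Cb_zero supn_def lipschitz_on_def)
qed

lemma wnorm_le: "(\<And>\<theta>. wtest \<theta> \<Longrightarrow> \<xi> \<theta> \<le> c) \<Longrightarrow> wnorm \<xi> \<le> c"
  unfolding wnorm_eq by (rule cSup_least) (use wtest_zero in auto)

lemma wnorm_upper:
  assumes "\<xi> \<in> Mspace" "wtest \<theta>"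
  shows "\<xi> \<theta> \<le> wnorm \<xi>"
  unfolding wnorm_eq
proof (rule cSup_upper)
  show "bdd_above {\<xi> \<theta> |\<theta>. wtest \<theta>}"
  proof (rule bdd_aboveI, safe)
    fix \<theta> :: "'a field" assume "wtest \<theta>"
    then have "\<bar>\<xi> \<theta>\<bar> \<le> Mnorm \<xi> * 1"
      by (intro Mspace_bound assms wtest_Cb wtest_norm_le)
    then show "\<xi> \<theta> \<le> Mnorm \<xi> * 1"
      by simp
  qed
qed (use assms in auto)

lemma wnorm_nonneg: "\<xi> \<in> Mspace \<Longrightarrow> 0 \<le> wnorm \<xi>"
  using wnorm_upper[OF _ wtest_zero, of \<xi>] Mspace_zero_field[of \<xi>] by simp

text \<open>\<open>wnorm\<close> is a supremum without absolute values; its symmetry comes from the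
  test fields being closed under negation.\<close>

lemma wnorm_minus_commute:
  assumes "\<xi> \<in> Mspace" "\<eta> \<in> Mspace"
  shows "wnorm (\<lambda>\<theta>. \<xi> \<theta> - \<eta> \<theta>) = wnorm (\<lambda>\<theta>. \<eta> \<theta> - \<xi> \<theta>)"
proof -
  have "wnorm (\<lambda>\<theta>. \<xi> \<theta> - \<eta> \<theta>) \<le> wnorm (\<lambda>\<theta>. \<eta> \<theta> - \<xi> \<theta>)" if "\<xi> \<in> Mspace" "\<eta> \<in> Mspace" for \<xi> \<eta> :: "'a current"
    using wnorm_upper[OF Mspace_minus[OF that(2,1)] wtest_uminus] that
    by (intro wnorm_le) (auto simp: Mspace_uminus wtest_Cb)
  then show ?thesis
    using assms by (auto intro: antisym)
qed

lemma wnorm_triangle_sub: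
  assumes "\<xi> \<in> Mspace" "\<eta> \<in> Mspace"
  shows "wnorm \<xi> \<le> wnorm \<eta> + wnorm (\<lambda>\<theta>. \<xi> \<theta> - \<eta> \<theta>)"
proof (rule wnorm_le)
  fix \<theta> :: "'a field" assume "wtest \<theta>"
  then show "\<xi> \<theta> \<le> wnorm \<eta> + wnorm (\<lambda>\<theta>. \<xi> \<theta> - \<eta> \<theta>)"
    using wnorm_upper[OF assms(2)] wnorm_upper[OF Mspace_minus[OF assms]] by fastforce
qed

section \<open>Transposes of Jacobians\<close>

text \<open>In coordinates, both the joint continuity in \<open>J\<close> and \<open>v\<close> and
  the linearity in \<open>J\<close> can be read off.\<close>

lemma adjoint_blinfun:
  fixes J :: "'a::euclidean_space \<Rightarrow>\<^sub>L 'a"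
  shows "adjoint (blinfun_apply J) v = (\<Sum>b\<in>Basis. (blinfun_apply J b \<bullet> v) *\<^sub>R b)"
proof -
  have "adjoint (blinfun_apply J) v = (\<Sum>b\<in>Basis. (adjoint (blinfun_apply J) v \<bullet> b) *\<^sub>R b)"
    by (simp add: euclidean_representation)
  also have "\<dots> = (\<Sum>b\<in>Basis. (blinfun_apply J b \<bullet> v) *\<^sub>R b)"
    using adjoint_works[OF bounded_linear.linear[OF blinfun.bounded_linear_right], of _ J v]
    by (simp add: inner_commute)
  finally show ?thesis .
qed

lemma adjoint_blinfun_diff_left:
  "adjoint (blinfun_apply (J - J')) v = adjoint (blinfun_apply J) v - adjoint (blinfun_apply J') v"
  for J :: "'a::euclidean_space \<Rightarrow>\<^sub>L 'a"
  by (simp add: adjoint_blinfun blinfun.diff_left inner_diff_left scaleR_diff_left sum_subtractf)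

lemma adjoint_blinfun_linear: "linear (adjoint (blinfun_apply J))"
  for J :: "'a::euclidean_space \<Rightarrow>\<^sub>L 'a"
  by (intro adjoint_linear bounded_linear.linear[OF blinfun.bounded_linear_right])

text \<open>From |J^T v|^2 = <J J^T v, v> <= |J| |J^T v| |v|, divided by |J^T v|.\<close>

lemma norm_adjoint_blinfun_le: "norm (adjoint (blinfun_apply J) v) \<le> norm J * norm v"
  for J :: "'a::euclidean_space \<Rightarrow>\<^sub>L 'a"
proof (cases "adjoint (blinfun_apply J) v = 0")
  case False
  let ?a = "adjoint (blinfun_apply J) v"
  have "norm ?a * norm ?a = ?a \<bullet> ?a"
    by (simp add: power2_norm_eq_inner flip: power2_eq_square)
  also have "\<dots> = blinfun_apply J ?a \<bullet> v"
    by (rule adjoint_works[OF bounded_linear.linear[OF blinfun.bounded_linear_right]])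
  also have "\<dots> \<le> norm (blinfun_apply J ?a) * norm v"
    by (rule norm_cauchy_schwarz)
  also have "\<dots> \<le> (norm J * norm ?a) * norm v"
    by (intro mult_right_mono norm_blinfun) auto
  finally have "norm ?a * norm ?a \<le> norm ?a * (norm J * norm v)"
    by (simp add: ac_simps)
  then show ?thesis
    using False by simp
qed auto

section \<open>Vector fields of class C2 and their flows\<close>

text \<open>Evaluation at a point thus commutes with time derivatives, so a differential equation in
  the function space yields one at every point x.\<close>

lemma bounded_linear_apply_bcontfun:
  "bounded_linear (\<lambda>f :: 'a::topological_space \<Rightarrow>\<^sub>C 'b::real_normed_vector. apply_bcontfun f x)"
  by (rule bounded_linear_intro[where K = 1]) (auto simp: norm_bounded)

lemma C2b_has_derivative:
  assumes "C2b f"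
  shows "(f has_derivative blinfun_apply (Dx f x)) (at x)"
    and "(Dx f has_derivative blinfun_apply (D2x f x)) (at x)"
proof -
  have "(f has_derivative frechet_derivative f (at x)) (at x)"
    "(Dx f has_derivative frechet_derivative (Dx f) (at x)) (at x)"
    using assms by (auto simp: C2b_def frechet_derivative_works)
  then show "(f has_derivative blinfun_apply (Dx f x)) (at x)"
    "(Dx f has_derivative blinfun_apply (D2x f x)) (at x)"
    unfolding Dx_def[of f x] D2x_def
    by (simp_all add: bounded_linear_Blinfun_apply[OF has_derivative_bounded_linear])
qed

lemma C2b_bounds:
  assumes "C2b f" "C2norm f \<le> K"
  shows "norm (f x) \<le> K" "norm (Dx f x) \<le> K" "norm (D2x f x) \<le> K"
proof -
  have "0 \<le> supn f" "0 \<le> supn (Dx f)" "0 \<le> supn (D2x f)"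
    using assms(1) by (auto simp: C2b_def supn_nonneg)
  moreover have "norm (f x) \<le> supn f" "norm (Dx f x) \<le> supn (Dx f)" "norm (D2x f x) \<le> supn (D2x f)"
    using assms(1) by (auto simp: C2b_def norm_le_supn)
  ultimately show "norm (f x) \<le> K" "norm (Dx f x) \<le> K" "norm (D2x f x) \<le> K"
    using assms(2) by (auto simp: C2norm_def)
qed

lemma C2norm_bound_nonneg: "C2b f \<Longrightarrow> C2norm f \<le> K \<Longrightarrow> 0 \<le> K"
  using C2b_bounds(1)[of f K] norm_ge_zero order_trans by blast

lemma C2b_lipschitz:
  assumes "C2b f" "C2norm f \<le> K"
  shows "norm (f x - f y) \<le> K * norm (x - y)" and "norm (Dx f x - Dx f y) \<le> K * norm (x - y)"
proof -
  show "norm (f x - f y) \<le> K * norm (x - y)"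
    by (rule differentiable_bound[OF convex_UNIV C2b_has_derivative(1)[OF assms(1)]])
      (use C2b_bounds(2)[OF assms] in \<open>auto simp: norm_blinfun.rep_eq\<close>)
  show "norm (Dx f x - Dx f y) \<le> K * norm (x - y)"
    by (rule differentiable_bound[OF convex_UNIV C2b_has_derivative(2)[OF assms(1)]])
      (use C2b_bounds(3)[OF assms] in \<open>auto simp: norm_blinfun.rep_eq\<close>)
qed

text \<open>The mean value inequality on the segment from x to y, along which the derivative varies
  by at most K |y - x| because of the bound on the second derivative.\<close>

lemma C2b_remainder:
  assumes "C2b f" "C2norm f \<le> K"
  shows "norm (f y - f x - Dx f x (y - x)) \<le> K * (norm (y - x))\<^sup>2"
proof -
  have "norm (f y - f x - Dx f x (y - x)) \<le> norm (y - x) * (K * norm (y - x))"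
  proof (rule differentiable_bound_linearization[where S = "closed_segment x y"
        and f' = "\<lambda>z. blinfun_apply (Dx f z)"])
    show "x + t *\<^sub>R (y - x) \<in> closed_segment x y" if "t \<in> {0..1}" for t
      using that by (auto simp: closed_segment_def algebra_simps intro!: exI[of _ t])
    show "(f has_derivative blinfun_apply (Dx f z)) (at z within closed_segment x y)" for z
      by (rule has_derivative_at_withinI[OF C2b_has_derivative(1)[OF assms(1)]])
    show "onorm (blinfun_apply (Dx f z) - blinfun_apply (Dx f x)) \<le> K * norm (y - x)"
      if "z \<in> closed_segment x y" for z
    proof -
      have "onorm (blinfun_apply (Dx f z) - blinfun_apply (Dx f x)) = norm (Dx f z - Dx f x)"
        by (simp add: norm_blinfun.rep_eq minus_blinfun.rep_eq fun_diff_def)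
      also have "\<dots> \<le> K * norm (z - x)"
        by (rule C2b_lipschitz[OF assms])
      also have "\<dots> \<le> K * norm (y - x)"
        using segment_bound[OF that]
        by (intro mult_left_mono C2norm_bound_nonneg[OF assms]) (auto simp: norm_minus_commute)
      finally show ?thesis .
    qed
  qed auto
  then show ?thesis
    by (simp add: power2_eq_square ac_simps)
qed

lemma C2b_continuous:
  assumes "C2b f"
  shows "continuous_on S f" "continuous_on S (Dx f)"
  using assms
  by (auto simp: C2b_def intro!: continuous_at_imp_continuous_on differentiable_imp_continuous_within)

text \<open>The quadratic Taylor remainder of the field makes the linearisation error of the flow
  quadratic in the initial displacement, by Gronwall.\<close>

lemma flow_has_derivative:
  fixes X :: "real \<Rightarrow> 'a::euclidean_space \<Rightarrow> 'a" and J :: "real \<Rightarrow> 'a \<Rightarrow> ('a \<Rightarrow>\<^sub>L 'a)"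
  assumes b: "\<And>t. t \<in> {0..T} \<Longrightarrow> C2b (b t)" "\<And>t. t \<in> {0..T} \<Longrightarrow> C2norm (b t) \<le> K"
    and X: "\<And>t x. t \<in> {0..T} \<Longrightarrow> ((\<lambda>s. X s x) has_vector_derivative b t (X t x)) (at t within {0..T})"
    and J: "\<And>t x. t \<in> {0..T} \<Longrightarrow>
      ((\<lambda>s. J s x) has_vector_derivative Dx (b t) (X t x) o\<^sub>L J t x) (at t within {0..T})"
    and init: "\<And>x. X 0 x = x" "\<And>x. J 0 x = id_blinfun"
    and t: "t \<in> {0..T}"
  shows "(X t has_derivative blinfun_apply (J t x)) (at x)"
proof -
  have K: "0 \<le> K"
    by (rule C2norm_bound_nonneg[OF b[OF t]])
  \<comment> \<open>Trajectories separate at most exponentially, which makes the Taylor remainder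
    along them quadratic in |y - x|.\<close>
  have X_lip: "norm (X s y - X s x) \<le> norm (y - x) * exp (K * T)" if s: "s \<in> {0..T}" for s y
  proof -
    have "norm (X s y - X s x) \<le> (norm (X 0 y - X 0 x) + 0 * T) * exp (K * s)"
      by (rule gronwall_norm[of T _ "\<lambda>t. b t (X t y) - b t (X t x)"])
        (use K s C2b_lipschitz[OF b] in \<open>auto intro!: has_vector_derivative_diff X\<close>)
    also have "\<dots> \<le> norm (y - x) * exp (K * T)"
      using K s by (auto simp: init intro!: mult_left_mono)
    finally show ?thesis .
  qed
  define C where "C = K * (exp (K * T))\<^sup>2 * T * exp (K * t)"
  have C: "C \<ge> 0"
    using K t by (auto simp: C_def)
  have quad: "norm (X t y - X t x - J t x (y - x)) \<le> C * (norm (y - x))\<^sup>2" for y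
  proof -
    define e where "e s = X s y - X s x - J s x (y - x)" for s
    define e' where "e' s = b s (X s y) - b s (X s x) - Dx (b s) (X s x) (J s x (y - x))" for s
    define a where "a = K * (norm (y - x) * exp (K * T))\<^sup>2"
    have "norm (e t) \<le> (norm (e 0) + a * T) * exp (K * t)"
    proof (rule gronwall_norm[of T e e'])
      fix s assume s: "s \<in> {0..T}"
      have "((\<lambda>s. J s x (y - x)) has_vector_derivative (Dx (b s) (X s x) o\<^sub>L J s x) (y - x)) (at s within {0..T})"
        by (rule bounded_linear.has_vector_derivative[OF blinfun.bounded_linear_left J[OF s]])
      then show "(e has_vector_derivative e' s) (at s within {0..T})"
        unfolding e_def e'_def by (auto intro!: has_vector_derivative_diff X s)
      let ?r = "b s (X s y) - b s (X s x) - Dx (b s) (X s x) (X s y - X s x)"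
      \<comment> \<open>Substituting J(y - x) = X y - X x - e turns \<open>e'\<close> into the
        Taylor remainder plus a term linear in \<open>e\<close>.\<close>
      have "e' s = ?r + Dx (b s) (X s x) (e s)"
        by (simp add: e'_def e_def blinfun.diff_right)
      then have "norm (e' s) \<le> norm ?r + norm (Dx (b s) (X s x) (e s))"
        by (simp add: norm_triangle_ineq)
      also have "norm ?r \<le> K * (norm (X s y - X s x))\<^sup>2"
        by (rule C2b_remainder[OF b[OF s]])
      also have "\<dots> \<le> a"
        unfolding a_def using K X_lip[OF s] by (intro mult_left_mono power_mono) auto
      also have "norm (Dx (b s) (X s x) (e s)) \<le> K * norm (e s)"
        using norm_blinfun[of "Dx (b s) (X s x)" "e s"] C2b_bounds(2)[OF b[OF s], of "X s x"]
        by (meson mult_right_mono norm_ge_zero order_trans)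
      finally show "norm (e' s) \<le> a + K * norm (e s)"
        by simp
    qed (use K t in \<open>auto simp: a_def\<close>)
    also have "\<dots> = C * (norm (y - x))\<^sup>2"
      by (simp add: e_def init C_def a_def power_mult_distrib)
    finally show ?thesis
      by (simp add: e_def)
  qed
  show ?thesis
    unfolding has_derivative_at_alt
  proof (intro conjI allI impI blinfun.bounded_linear_right)
    fix \<epsilon> :: real assume \<epsilon>: "0 < \<epsilon>"
    show "\<exists>d>0. \<forall>y. norm (y - x) < d \<longrightarrow> norm (X t y - X t x - J t x (y - x)) \<le> \<epsilon> * norm (y - x)"
    \<comment> \<open>The denominator C + 1 covers the case C = 0.\<close>
    proof (intro exI[of _ "\<epsilon> / (C + 1)"] conjI allI impI)
      fix y assume "norm (y - x) < \<epsilon> / (C + 1)"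
      then have "(C + 1) * norm (y - x) \<le> \<epsilon>"
        using C by (simp add: field_simps)
      then have "C * norm (y - x) \<le> \<epsilon>"
        using norm_ge_zero[of "y - x"] unfolding distrib_right mult_1 by linarith
      then have "C * norm (y - x) * norm (y - x) \<le> \<epsilon> * norm (y - x)"
        by (rule mult_right_mono) auto
      then show "norm (X t y - X t x - J t x (y - x)) \<le> \<epsilon> * norm (y - x)"
        using quad[of y] by (simp add: power2_eq_square)
    qed (use \<epsilon> C in auto)
  qed
qed

section \<open>Composition operators on displacements and Jacobians\<close>

text \<open>Since id + u is unbounded, it is the displacement \<open>u\<close> that can be a point
  of the space of bounded continuous functions.\<close>

definition comp_field :: "'a field \<Rightarrow> ('a \<Rightarrow>\<^sub>C 'a) \<Rightarrow> ('a \<Rightarrow>\<^sub>C 'a::euclidean_space)" where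
  "comp_field f u = Bcontfun (\<lambda>x. f (x + u x))"

text \<open>\<open>J\<close> is meant to be the derivative of id + u but is an independent unknown:
  extracting it from \<open>u\<close> would put a derivative on the right-hand side and destroy the
  Lipschitz property in the sup norm.\<close>

definition comp_deriv ::
  "'a field \<Rightarrow> ('a \<Rightarrow>\<^sub>C 'a) \<Rightarrow> ('a \<Rightarrow>\<^sub>C ('a \<Rightarrow>\<^sub>L 'a)) \<Rightarrow> ('a \<Rightarrow>\<^sub>C ('a \<Rightarrow>\<^sub>L 'a::euclidean_space))" where
  "comp_deriv f u J = Bcontfun (\<lambda>x. Dx f (x + u x) o\<^sub>L J x)"

lemma norm_blinfun_compose_bounds:
  assumes "norm F \<le> K" "norm J \<le> M"
  shows "norm (F o\<^sub>L J) \<le> K * M"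
  using norm_blinfun_compose[of F J] mult_mono[OF assms] norm_ge_zero[of F] norm_ge_zero[of J] assms
  by linarith

lemma apply_comp_field:
  assumes "C2b f"
  shows "apply_bcontfun (comp_field f u) x = f (x + u x)"
proof -
  have "continuous_on UNIV (\<lambda>x. f (x + u x))"
    by (intro continuous_on_compose2[OF C2b_continuous(1)[OF assms]] continuous_intros) auto
  then have "(\<lambda>x. f (x + u x)) \<in> bcontfun"
    using C2b_bounds(1)[OF assms order_refl] by (rule bcontfun_normI)
  then show ?thesis
    by (simp add: comp_field_def Bcontfun_inverse)
qed

lemma apply_comp_deriv:
  assumes "C2b f"
  shows "apply_bcontfun (comp_deriv f u J) x = Dx f (x + u x) o\<^sub>L J x"
proof -
  have "continuous_on UNIV (\<lambda>x. Dx f (x + u x) o\<^sub>L J x)"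
    by (intro continuous_intros continuous_on_compose2[OF C2b_continuous(2)[OF assms]]) auto
  moreover have "norm (Dx f (x + u x) o\<^sub>L J x) \<le> C2norm f * norm J" for x
    by (intro norm_blinfun_compose_bounds C2b_bounds(2)[OF assms order_refl] norm_bounded)
  ultimately have "(\<lambda>x. Dx f (x + u x) o\<^sub>L J x) \<in> bcontfun"
    by (rule bcontfun_normI)
  then show ?thesis
    by (simp add: comp_deriv_def Bcontfun_inverse)
qed

lemma norm_comp_field_le: "C2b f \<Longrightarrow> C2norm f \<le> K \<Longrightarrow> norm (comp_field f u) \<le> K"
  by (rule norm_bound) (simp add: apply_comp_field C2b_bounds)

lemma norm_comp_deriv_le: "C2b f \<Longrightarrow> C2norm f \<le> K \<Longrightarrow> norm (comp_deriv f u J) \<le> K * norm J"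
  by (rule norm_bound) (simp add: apply_comp_deriv C2b_bounds norm_blinfun_compose_bounds norm_bounded)

lemma norm_apply_diff_le: "norm (apply_bcontfun u x - apply_bcontfun v x) \<le> norm (u - v)"
  using norm_bounded[of "u - v" x] by simp

text \<open>Splits the difference into a change of field at x + u and a change of argument inside
  \<open>g\<close>, so the C2 bound is asked of \<open>g\<close> alone.\<close>

lemma norm_comp_field_diff_le:
  assumes f: "C2b f" and g: "C2b g" "C2norm g \<le> K" and d: "\<And>x. norm (f x - g x) \<le> d"
  shows "norm (comp_field f u - comp_field g v) \<le> d + K * norm (u - v)"
proof (rule norm_bound)
  fix x
  have "norm (g (x + u x) - g (x + v x)) \<le> K * norm ((x + u x) - (x + v x))"
    by (rule C2b_lipschitz[OF g])
  also have "\<dots> \<le> K * norm (u - v)"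
    using norm_apply_diff_le[of u x v] by (intro mult_left_mono C2norm_bound_nonneg[OF g]) auto
  finally show "norm (apply_bcontfun (comp_field f u - comp_field g v) x) \<le> d + K * norm (u - v)"
    using d[of "x + u x"] norm_triangle_ineq[of "f (x + u x) - g (x + u x)" "g (x + u x) - g (x + v x)"]
    by (simp add: apply_comp_field f g)
qed

text \<open>Uses F J - G J' = (F - G) J + G (J - J'). Moving the point inside \<open>Dx g\<close>
  costs its Lipschitz constant, that is, the bound on the second derivative.\<close>

lemma norm_comp_deriv_diff_le:
  assumes f: "C2b f" and g: "C2b g" "C2norm g \<le> K" and d: "\<And>x. norm (Dx f x - Dx g x) \<le> d"
  shows "norm (comp_deriv f u J - comp_deriv g v J') \<le> (d + K * norm (u - v)) * norm J + K * norm (J - J')"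
proof (rule norm_bound)
  fix x
  let ?F = "Dx f (x + u x)" and ?G = "Dx g (x + v x)"
  have "norm (Dx g (x + u x) - ?G) \<le> K * norm ((x + u x) - (x + v x))"
    by (rule C2b_lipschitz[OF g])
  also have "\<dots> \<le> K * norm (u - v)"
    using norm_apply_diff_le[of u x v] by (intro mult_left_mono C2norm_bound_nonneg[OF g]) auto
  finally have "norm (?F - ?G) \<le> d + K * norm (u - v)"
    using d[of "x + u x"] norm_triangle_ineq[of "?F - Dx g (x + u x)" "Dx g (x + u x) - ?G"]
    by simp
  then have "norm ((?F - ?G) o\<^sub>L J x) \<le> (d + K * norm (u - v)) * norm J"
    by (intro norm_blinfun_compose_bounds norm_bounded)
  moreover have "norm (?G o\<^sub>L (J x - J' x)) \<le> K * norm (J - J')"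
    by (intro norm_blinfun_compose_bounds C2b_bounds[OF g] norm_apply_diff_le)
  moreover have "(?F o\<^sub>L J x) - (?G o\<^sub>L J' x) = ((?F - ?G) o\<^sub>L J x) + (?G o\<^sub>L (J x - J' x))"
    by (rule blinfun_eqI) (simp add: blinfun.diff_left blinfun.diff_right blinfun.add_left)
  ultimately show "norm (apply_bcontfun (comp_deriv f u J - comp_deriv g v J') x)
      \<le> (d + K * norm (u - v)) * norm J + K * norm (J - J')"
    using norm_triangle_ineq[of "(?F - ?G) o\<^sub>L J x" "?G o\<^sub>L (J x - J' x)"]
    by (simp add: apply_comp_deriv f g)
qed

section \<open>The flow equation as an ordinary differential equation\<close>

lemma norm_components_diff_le:
  "norm (fst v - fst w) \<le> norm (v - w)" "norm (snd v - snd w) \<le> norm (v - w)"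
  for v w :: "'a::real_normed_vector \<times> 'b::real_normed_vector"
  by (metis fst_diff norm_fst_le prod.collapse) (metis snd_diff norm_snd_le prod.collapse)

section \<open>Push-forward of currents by a displacement-Jacobian pair\<close>

text \<open>This is \<open>push_field\<close> with \<open>snd w\<close> in place of the derivative
  of id + \<open>fst w\<close>, whether or not it is that derivative. The push-forward is thereby
  defined on the whole Banach space.\<close>

definition pull_field ::
  "('a \<Rightarrow>\<^sub>C 'a) \<times> ('a \<Rightarrow>\<^sub>C ('a \<Rightarrow>\<^sub>L 'a)) \<Rightarrow> 'a field \<Rightarrow> 'a::euclidean_space field" where
  "pull_field w \<theta> = (\<lambda>x. adjoint (blinfun_apply (snd w x)) (\<theta> (x + fst w x)))"

definition flow_current ::
  "'a current \<Rightarrow> ('a \<Rightarrow>\<^sub>C 'a) \<times> ('a \<Rightarrow>\<^sub>C ('a \<Rightarrow>\<^sub>L 'a)) \<Rightarrow> 'a::euclidean_space current" where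
  "flow_current \<xi> w = (\<lambda>\<theta>. if Cb \<theta> then \<xi> (pull_field w \<theta>) else 0)"

lemma norm_pull_field_le:
  assumes "\<And>x. norm (\<theta> x) \<le> c"
  shows "norm (pull_field w \<theta> x) \<le> norm (snd w) * c"
proof -
  have "norm (pull_field w \<theta> x) \<le> norm (snd w x) * norm (\<theta> (x + fst w x))"
    unfolding pull_field_def by (rule norm_adjoint_blinfun_le)
  also have "\<dots> \<le> norm (snd w) * c"
    by (intro mult_mono norm_bounded assms) auto
  finally show ?thesis .
qed

lemma Cb_pull_field:
  assumes "Cb \<theta>"
  shows "Cb (pull_field w \<theta>)"
proof (rule CbI)
  have "continuous_on UNIV (\<lambda>x. x + fst w x)"
    by (intro continuous_on_add continuous_on_id continuous_on_apply_bcontfun)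
  moreover have "continuous_on UNIV \<theta>"
    using assms by (simp add: Cb_def)
  ultimately have "continuous_on UNIV (\<lambda>x. \<theta> (x + fst w x))"
    by (auto intro: continuous_on_compose2)
  then show "continuous_on UNIV (pull_field w \<theta>)"
    unfolding pull_field_def adjoint_blinfun by (intro continuous_intros) auto
  show "norm (pull_field w \<theta> x) \<le> norm (snd w) * supn \<theta>" for x
    by (intro norm_pull_field_le Cb_norm_le_supn assms)
qed

lemma flow_current_in_Mspace:
  assumes \<xi>: "\<xi> \<in> Mspace"
  shows "flow_current \<xi> w \<in> Mspace"
proof -
  have add: "pull_field w (\<lambda>x. \<theta> x + \<eta> x) = (\<lambda>x. pull_field w \<theta> x + pull_field w \<eta> x)" for \<theta> \<eta>
    by (simp add: pull_field_def linear_add[OF adjoint_blinfun_linear])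
  have scale: "pull_field w (\<lambda>x. c *\<^sub>R \<theta> x) = (\<lambda>x. c *\<^sub>R pull_field w \<theta> x)" for \<theta> c
    by (simp add: pull_field_def linear_scale[OF adjoint_blinfun_linear])
  have "\<bar>flow_current \<xi> w \<theta>\<bar> \<le> (Mnorm \<xi> * norm (snd w)) * supn \<theta>" if "Cb \<theta>" for \<theta>
    using Mspace_bound[OF \<xi> Cb_pull_field[OF that] norm_pull_field_le[OF Cb_norm_le_supn[OF that]]] that
    by (simp add: flow_current_def ac_simps)
  then have "\<exists>K. \<forall>\<theta>. Cb \<theta> \<longrightarrow> \<bar>flow_current \<xi> w \<theta>\<bar> \<le> K * supn \<theta>"
    by blast
  moreover have "flow_current \<xi> w (\<lambda>x. \<theta> x + \<eta> x) = flow_current \<xi> w \<theta> + flow_current \<xi> w \<eta>"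
    if "Cb \<theta>" "Cb \<eta>" for \<theta> \<eta>
    using that Mspace_add[OF \<xi> Cb_pull_field Cb_pull_field, of \<theta> \<eta> w w]
    by (simp add: flow_current_def Cb_add add)
  moreover have "flow_current \<xi> w (\<lambda>x. c *\<^sub>R \<theta> x) = c * flow_current \<xi> w \<theta>" if "Cb \<theta>" for \<theta> c
    using that Mspace_scaleR[OF \<xi> Cb_pull_field, of \<theta> c w]
    by (simp add: flow_current_def Cb_scaleR scale)
  moreover have "flow_current \<xi> w \<theta> = 0" if "\<not> Cb \<theta>" for \<theta>
    using that by (simp add: flow_current_def)
  ultimately show ?thesis
    unfolding Mspace_def by blast
qed

lemma wnorm_flow_current_le:
  assumes \<xi>: "\<xi> \<in> Mspace"
  shows "wnorm (flow_current \<xi> w) \<le> Mnorm \<xi> * norm (snd w)"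
proof (rule wnorm_le)
  fix \<theta> :: "'a field" assume \<theta>: "wtest \<theta>"
  have "\<bar>\<xi> (pull_field w \<theta>)\<bar> \<le> Mnorm \<xi> * (norm (snd w) * 1)"
    by (intro Mspace_bound \<xi> Cb_pull_field norm_pull_field_le wtest_Cb wtest_norm_le \<theta>)
  then show "flow_current \<xi> w \<theta> \<le> Mnorm \<xi> * norm (snd w)"
    using wtest_Cb[OF \<theta>] by (simp add: flow_current_def)
qed

text \<open>Test fields are bounded by 1 and 1-Lipschitz: the first bound controls the change of
  Jacobian, the second the change of displacement. For merely continuous fields the second change
  would have no uniform modulus, so the weak norm is essential.\<close>

lemma wnorm_flow_current_diff_le:
  assumes \<xi>: "\<xi> \<in> Mspace"
  shows "wnorm (\<lambda>\<theta>. flow_current \<xi> w \<theta> - flow_current \<xi> w' \<theta>)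
    \<le> Mnorm \<xi> * (norm (snd w - snd w') + norm (snd w') * norm (fst w - fst w'))"
proof (rule wnorm_le)
  fix \<theta> :: "'a field" assume \<theta>: "wtest \<theta>"
  let ?C = "norm (snd w - snd w') + norm (snd w') * norm (fst w - fst w')"
  have Cb: "Cb (pull_field w \<theta>)" "Cb (pull_field w' \<theta>)"
    using \<theta> by (auto intro: Cb_pull_field wtest_Cb)
  have le: "norm (pull_field w \<theta> x - pull_field w' \<theta> x) \<le> ?C" for x
  proof -
    let ?J = "snd w x" and ?J' = "snd w' x" and ?y = "x + fst w x" and ?y' = "x + fst w' x"
    have "pull_field w \<theta> x - pull_field w' \<theta> x
        = adjoint (blinfun_apply (?J - ?J')) (\<theta> ?y) + adjoint (blinfun_apply ?J') (\<theta> ?y - \<theta> ?y')"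
      by (simp add: pull_field_def adjoint_blinfun_diff_left linear_diff[OF adjoint_blinfun_linear])
    moreover have "norm (adjoint (blinfun_apply (?J - ?J')) (\<theta> ?y)) \<le> norm (snd w - snd w') * 1"
      by (intro order_trans[OF norm_adjoint_blinfun_le] mult_mono norm_apply_diff_le wtest_norm_le \<theta>) auto
    moreover have "norm (\<theta> ?y - \<theta> ?y') \<le> norm (fst w - fst w')"
      using wtest_lipschitz[OF \<theta>, of ?y ?y'] norm_apply_diff_le[of "fst w" x "fst w'"] by simp
    then have "norm (adjoint (blinfun_apply ?J') (\<theta> ?y - \<theta> ?y')) \<le> norm (snd w') * norm (fst w - fst w')"
      by (intro order_trans[OF norm_adjoint_blinfun_le] mult_mono norm_bounded) auto
    ultimately show ?thesis
      by (simp add: norm_triangle_le)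
  qed
  have "Cb (\<lambda>x. pull_field w \<theta> x - pull_field w' \<theta> x)"
    using Cb_add[OF Cb(1) Cb_uminus[OF Cb(2)]] by simp
  then have "\<bar>\<xi> (\<lambda>x. pull_field w \<theta> x - pull_field w' \<theta> x)\<bar> \<le> Mnorm \<xi> * ?C"
    by (intro Mspace_bound \<xi> le)
  then show "flow_current \<xi> w \<theta> - flow_current \<xi> w' \<theta> \<le> Mnorm \<xi> * ?C"
    using wtest_Cb[OF \<theta>] Mspace_diff[OF \<xi> Cb] by (simp add: flow_current_def)
qed

text \<open>Joins the encoding to the geometric push-forward, once the second component is known to
  be the derivative of the flow.\<close>

lemma push_current_eq_flow_current:
  fixes w :: "('a \<Rightarrow>\<^sub>C 'a) \<times> ('a \<Rightarrow>\<^sub>C ('a \<Rightarrow>\<^sub>L 'a::euclidean_space))"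
  assumes "\<And>x. \<phi> x = x + fst w x" and "\<And>x. (\<phi> has_derivative blinfun_apply (snd w x)) (at x)"
  shows "push_current \<phi> \<xi> = flow_current \<xi> w"
proof -
  have "frechet_derivative \<phi> (at x) = blinfun_apply (snd w x)" for x
    using frechet_derivative_at[OF assms(2)] by simp
  then have "push_field \<phi> \<theta> = pull_field w \<theta>" for \<theta>
    by (simp add: push_field_def pull_field_def assms(1))
  then show ?thesis
    by (auto simp: push_current_def flow_current_def cong: if_cong)
qed

lemma Mnorm_nonneg: "\<xi> \<in> Mspace \<Longrightarrow> 0 \<le> Mnorm \<xi>"
  using Mnorm_upper[of \<xi> "\<lambda>x. 0"] Cb_zero by (force simp: supn_def)

section \<open>The autonomous equation for the pair\<close>

text \<open>The parameter \<open>R\<close> replaces the exact norm of \<open>\<xi>0\<close>, so that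
  the bounds, and with them the existence time, depend on \<open>CB\<close> and \<open>R\<close>
  only.\<close>

locale current_flow =
  fixes B :: "('a::euclidean_space) current \<Rightarrow> 'a field" and CB :: real and \<xi>0 :: "'a current" and R :: real
  assumes standing: "standing_assumptions B CB"
    and \<xi>0: "\<xi>0 \<in> Mspace" "Mnorm \<xi>0 \<le> R"
begin

abbreviation cur :: "('a \<Rightarrow>\<^sub>C 'a) \<times> ('a \<Rightarrow>\<^sub>C ('a \<Rightarrow>\<^sub>L 'a)) \<Rightarrow> 'a current" where
  "cur \<equiv> flow_current \<xi>0"

text \<open>The field is evaluated at a current built from the whole pair, so the equation is
  nonlocal in x and must be posed in a function space.\<close>

definition velocity where
  "velocity w = (comp_field (B (cur w)) (fst w), comp_deriv (B (cur w)) (fst w) (snd w))"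

definition w0 :: "('a \<Rightarrow>\<^sub>C 'a) \<times> ('a \<Rightarrow>\<^sub>C ('a \<Rightarrow>\<^sub>L 'a))" where
  "w0 = (0, const_bcontfun id_blinfun)"

text \<open>Bounds the C2 norm of the field whenever |J| <= M, because the pushed current then has
  weak norm at most R M.\<close>

definition field_bound :: "real \<Rightarrow> real" where
  "field_bound M = CB * (R * M + 1)"

text \<open>The bound on the Jacobian belongs to the notion because \<open>velocity\<close> is shown
  Lipschitz on bounded sets of Jacobians.\<close>

definition trajectory where
  "trajectory T M w \<longleftrightarrow> w 0 = w0 \<and> (\<forall>t\<in>{0..T}. norm (snd (w t)) \<le> M \<and>
     (w has_vector_derivative velocity (w t)) (at t within {0..T}))"

lemma CB_pos: "0 < CB"
  using standing by (simp add: standing_assumptions_def)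

lemma R_nonneg: "0 \<le> R"
  using Mnorm_nonneg \<xi>0 by force

lemma C2b_B: "\<xi> \<in> Mspace \<Longrightarrow> C2b (B \<xi>)"
  and C2norm_B: "\<xi> \<in> Mspace \<Longrightarrow> C2norm (B \<xi>) \<le> CB * (wnorm \<xi> + 1)"
  using standing by (simp_all add: standing_assumptions_def)

lemma B_diff_le:
  assumes "\<xi> \<in> Mspace" "\<eta> \<in> Mspace"
  shows "norm (B \<xi> x - B \<eta> x) \<le> CB * wnorm (\<lambda>\<theta>. \<xi> \<theta> - \<eta> \<theta>)"
    and "norm (Dx (B \<xi>) x - Dx (B \<eta>) x) \<le> CB * wnorm (\<lambda>\<theta>. \<xi> \<theta> - \<eta> \<theta>)"
proof -
  have "bounded (range (\<lambda>x. B \<xi> x - B \<eta> x))" "bounded (range (\<lambda>x. Dx (B \<xi>) x - Dx (B \<eta>) x))"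
    using C2b_B[OF assms(1)] C2b_B[OF assms(2)] by (auto simp: C2b_def intro: bounded_minus_comp)
  from this[THEN norm_le_supn, of x]
  show "norm (B \<xi> x - B \<eta> x) \<le> CB * wnorm (\<lambda>\<theta>. \<xi> \<theta> - \<eta> \<theta>)"
    and "norm (Dx (B \<xi>) x - Dx (B \<eta>) x) \<le> CB * wnorm (\<lambda>\<theta>. \<xi> \<theta> - \<eta> \<theta>)"
    using standing assms unfolding standing_assumptions_def by (meson order_trans)+
qed

lemma cur_Mspace: "cur w \<in> Mspace"
  by (rule flow_current_in_Mspace[OF \<xi>0(1)])

lemma wnorm_cur_le: "norm (snd w) \<le> M \<Longrightarrow> wnorm (cur w) \<le> R * M"
  using wnorm_flow_current_le[OF \<xi>0(1), of w] mult_mono[OF \<xi>0(2), of "norm (snd w)" M] R_nonneg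
  by simp

lemma wnorm_cur_diff_le:
  assumes "norm (snd w') \<le> M"
  shows "wnorm (\<lambda>\<theta>. cur w \<theta> - cur w' \<theta>) \<le> R * (1 + M) * norm (w - w')"
proof -
  note * = norm_components_diff_le[of w w']
  have "norm (snd w') * norm (fst w - fst w') \<le> M * norm (w - w')"
    using order_trans[OF norm_ge_zero assms] by (intro mult_mono assms *) auto
  then have "norm (snd w - snd w') + norm (snd w') * norm (fst w - fst w') \<le> (1 + M) * norm (w - w')"
    using * by (simp add: distrib_right)
  then have "Mnorm \<xi>0 * (norm (snd w - snd w') + norm (snd w') * norm (fst w - fst w'))
      \<le> R * ((1 + M) * norm (w - w'))"
    using R_nonneg by (intro mult_mono \<xi>0) auto
  then show ?thesis
    using wnorm_flow_current_diff_le[OF \<xi>0(1), of w w'] by (simp add: ac_simps)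
qed

lemma C2norm_B_cur: "norm (snd w) \<le> M \<Longrightarrow> C2norm (B (cur w)) \<le> field_bound M"
  unfolding field_bound_def using wnorm_cur_le[of w M] CB_pos
  by (intro order_trans[OF C2norm_B[OF cur_Mspace]] mult_left_mono) auto

lemma field_bound_pos: "0 \<le> M \<Longrightarrow> 0 < field_bound M"
  using CB_pos R_nonneg by (simp add: field_bound_def add_nonneg_pos)

lemma norm_velocity_le:
  assumes "norm (snd w) \<le> M"
  shows "norm (velocity w) \<le> field_bound M * (1 + M)"
proof -
  note C2 = C2b_B[OF cur_Mspace] C2norm_B_cur[OF assms]
  have "norm (velocity w) \<le> field_bound M + field_bound M * norm (snd w)"
    unfolding velocity_def
    by (intro order_trans[OF norm_Pair_le] add_mono norm_comp_field_le norm_comp_deriv_le C2)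
  also have "\<dots> \<le> field_bound M + field_bound M * M"
    by (intro add_left_mono mult_left_mono assms C2norm_bound_nonneg[OF C2])
  finally show ?thesis
    by (simp add: distrib_left)
qed

text \<open>The pair determines the current in a Lipschitz way for the weak norm, and
  \<open>B\<close> is Lipschitz from the weak norm into C1. The motion of the evaluation point
  inside the derivative is paid for by the C2 bound.\<close>

lemma velocity_lipschitz:
  assumes "M \<ge> 0"
  obtains L where "L \<ge> 0" "\<And>w w'. norm (snd w) \<le> M \<Longrightarrow> norm (snd w') \<le> M \<Longrightarrow>
    norm (velocity w - velocity w') \<le> L * norm (w - w')"
proof -
  define K where "K = field_bound M"
  \<comment> \<open>The first summand accounts for the change of current, \<open>K\<close> for the
    change of displacement.\<close>
  define A where "A = CB * R * (1 + M) + K"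
  have K: "0 \<le> K"
    using field_bound_pos[OF assms] by (simp add: K_def)
  then have A: "0 \<le> A"
    using CB_pos R_nonneg assms by (simp add: A_def)
  show thesis
  proof
    show "0 \<le> A + A * M + K"
      using A K assms by simp
    fix w w' :: "('a \<Rightarrow>\<^sub>C 'a) \<times> ('a \<Rightarrow>\<^sub>C ('a \<Rightarrow>\<^sub>L 'a))"
    assume w: "norm (snd w) \<le> M" and w': "norm (snd w') \<le> M"
    define n where "n = norm (w - w')"
    have n: "norm (snd w - snd w') \<le> n" "norm (fst w - fst w') \<le> n" "0 \<le> n"
      using norm_components_diff_le[of w w'] by (simp_all add: n_def)
    define d where "d = CB * (R * (1 + M) * n)"
    have "CB * wnorm (\<lambda>\<theta>. cur w \<theta> - cur w' \<theta>) \<le> d"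
      using wnorm_cur_diff_le[OF w', of w] CB_pos by (simp add: d_def n_def)
    then have d: "norm (B (cur w) x - B (cur w') x) \<le> d"
      "norm (Dx (B (cur w)) x - Dx (B (cur w')) x) \<le> d" for x
      using B_diff_le[OF cur_Mspace[of w] cur_Mspace[of w'], of x] by auto
    have An: "d + K * norm (fst w - fst w') \<le> A * n"
      using mult_left_mono[OF n(2) K] by (simp add: d_def A_def algebra_simps)
    note C2 = C2b_B[OF cur_Mspace] C2b_B[OF cur_Mspace] C2norm_B_cur[OF w', folded K_def]
    have "norm (fst (velocity w - velocity w')) \<le> A * n"
      using norm_comp_field_diff_le[OF C2 d(1), of "fst w" "fst w'"] An by (simp add: velocity_def)
    moreover have "norm (snd (velocity w - velocity w')) \<le> A * n * M + K * n"
    proof -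
      have "norm (snd (velocity w - velocity w'))
          \<le> (d + K * norm (fst w - fst w')) * norm (snd w) + K * norm (snd w - snd w')"
        using norm_comp_deriv_diff_le[OF C2 d(2), of "fst w" "snd w" "fst w'" "snd w'"]
        by (simp add: velocity_def)
      also have "\<dots> \<le> A * n * M + K * n"
        using A n K by (intro add_mono mult_mono An w) auto
      finally show ?thesis .
    qed
    moreover have "norm (velocity w - velocity w')
        \<le> norm (fst (velocity w - velocity w')) + norm (snd (velocity w - velocity w'))"
      by (metis norm_Pair_le prod.collapse)
    ultimately show "norm (velocity w - velocity w') \<le> (A + A * M + K) * norm (w - w')"
      by (simp add: n_def algebra_simps)
  qed
qed

text \<open>In the unit ball around \<open>w0\<close> the Jacobian has norm at most 2, so the speed
  is at most \<open>field_bound 2 * (1 + 2)\<close>. The condition on T keeps Picard iterates within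
  distance 1 of \<open>w0\<close>.\<close>

lemma trajectory_exists:
  assumes T: "0 \<le> T" "3 * field_bound 2 * T \<le> 1"
  obtains w where "trajectory T 2 w"
proof -
  obtain L where L: "L \<ge> 0" "\<And>w w'. norm (snd w) \<le> 2 \<Longrightarrow> norm (snd w') \<le> 2 \<Longrightarrow>
    norm (velocity w - velocity w') \<le> L * norm (w - w')"
    using velocity_lipschitz[of 2] by auto
  have ball: "norm (snd w) \<le> 2" if "w \<in> cball w0 1" for w
  proof -
    have "norm (const_bcontfun id_blinfun :: 'a \<Rightarrow>\<^sub>C ('a \<Rightarrow>\<^sub>L 'a)) \<le> 1"
      by (rule norm_bound) (simp add: norm_blinfun_id_le)
    moreover have "norm (snd w - const_bcontfun id_blinfun) \<le> 1"
      using that norm_components_diff_le(2)[of w w0] by (simp add: w0_def dist_norm norm_minus_commute)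
    ultimately show ?thesis
      using norm_triangle_sub[of "snd w" "const_bcontfun id_blinfun"] by linarith
  qed
  have lip: "L-lipschitz_on (cball w0 1) velocity"
    by (rule lipschitz_onI) (use L ball in \<open>auto simp: dist_norm\<close>)
  obtain w where w: "w ` {0..T} \<subseteq> cball w0 1" "w 0 = w0"
    "\<And>t. t \<in> {0..T} \<Longrightarrow> (w has_vector_derivative velocity (w t)) (at t within {0..T})"
  proof (rule ode_exists[of T "cball w0 1" w0 L "\<lambda>t. velocity"])
    fix w :: "real \<Rightarrow> ('a \<Rightarrow>\<^sub>C 'a) \<times> ('a \<Rightarrow>\<^sub>C ('a \<Rightarrow>\<^sub>L 'a))" and t
    assume w: "continuous_on {0..T} w" "w ` {0..T} \<subseteq> cball w0 1" and t: "t \<in> {0..T}"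
    have "continuous_on {0..t} (\<lambda>s. velocity (w s))"
      by (rule continuous_on_compose2[OF lipschitz_on_continuous_on[OF lip] continuous_on_subset[OF w(1)]])
        (use w t in auto)
    then have "norm (integral {0..t} (\<lambda>s. velocity (w s))) \<le> 3 * field_bound 2 * (t - 0)"
    proof (rule integral_bound[rotated])
      show "norm (velocity (w s)) \<le> 3 * field_bound 2" if "s \<in> {0..t}" for s
        using norm_velocity_le[OF ball, of "w s"] w(2) that t by (simp add: image_subset_iff)
    qed (use t in auto)
    also have "\<dots> \<le> 3 * field_bound 2 * T"
      using t field_bound_pos[of 2] by (intro mult_left_mono) auto
    finally show "w0 + integral {0..t} (\<lambda>s. velocity (w s)) \<in> cball w0 1"
      using T by (simp add: dist_norm)
  qed (use T lip in auto)
  then have "trajectory T 2 w"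
    using ball by (auto simp: trajectory_def image_subset_iff)
  then show thesis
    by (rule that)
qed

text \<open>The bounds may differ because a trajectory extracted from a given solution brings its
  own; \<open>velocity\<close> is Lipschitz on the set given by the larger one.\<close>

lemma trajectory_unique:
  assumes v: "trajectory T M v" and w: "trajectory T M' w" and t: "t \<in> {0..T}"
  shows "v t = w t"
proof -
  have M: "max M M' \<ge> 0"
    using v t order_trans[OF norm_ge_zero, of "snd (v t)" M] by (auto simp: trajectory_def le_max_iff_disj)
  obtain L where L: "L \<ge> 0" "\<And>w w'. norm (snd w) \<le> max M M' \<Longrightarrow> norm (snd w') \<le> max M M' \<Longrightarrow>
    norm (velocity w - velocity w') \<le> L * norm (w - w')"
    using velocity_lipschitz[OF M] by auto
  show ?thesis
    by (rule ode_unique[of T v "\<lambda>t. velocity (v t)" w "\<lambda>t. velocity (w t)" L])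
      (use v w t L in \<open>auto simp: trajectory_def le_max_iff_disj\<close>)
qed

end

section \<open>Passage between trajectories and solutions\<close>

text \<open>The time-dependent field is arbitrary, so that this serves both the field generated by a
  trajectory and the one frozen along a given solution.\<close>

lemma displacement_flow:
  fixes b :: "real \<Rightarrow> 'a::euclidean_space field"
  assumes b: "\<And>t. t \<in> {0..T} \<Longrightarrow> C2b (b t)"
    and u: "\<And>t. t \<in> {0..T} \<Longrightarrow> (u has_vector_derivative comp_field (b t) (u t)) (at t within {0..T})"
    and t: "t \<in> {0..T}"
  shows "((\<lambda>s. x + apply_bcontfun (u s) x) has_vector_derivative b t (x + u t x)) (at t within {0..T})"
  using bounded_linear.has_vector_derivative[OF bounded_linear_apply_bcontfun u[OF t], of x]
    apply_comp_field[OF b[OF t], of "u t" x]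
  by (auto intro!: derivative_eq_intros)

lemma displacement_flow_has_derivative:
  fixes b :: "real \<Rightarrow> 'a::euclidean_space field"
  assumes b: "\<And>t. t \<in> {0..T} \<Longrightarrow> C2b (b t)" "\<And>t. t \<in> {0..T} \<Longrightarrow> C2norm (b t) \<le> K"
    and u: "\<And>t. t \<in> {0..T} \<Longrightarrow> (u has_vector_derivative comp_field (b t) (u t)) (at t within {0..T})"
    and J: "\<And>t. t \<in> {0..T} \<Longrightarrow> (J has_vector_derivative comp_deriv (b t) (u t) (J t)) (at t within {0..T})"
    and init: "u 0 = 0" "J 0 = const_bcontfun id_blinfun"
    and t: "t \<in> {0..T}"
  shows "((\<lambda>x. x + apply_bcontfun (u t) x) has_derivative blinfun_apply (J t x)) (at x)"
proof (rule flow_has_derivative[OF b, where X = "\<lambda>s x. x + apply_bcontfun (u s) x"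
      and J = "\<lambda>s x. apply_bcontfun (J s) x"])
  show "((\<lambda>s. x + apply_bcontfun (u s) x) has_vector_derivative b s (x + u s x)) (at s within {0..T})"
    if "s \<in> {0..T}" for s x
    by (rule displacement_flow[OF b(1) u that])
  show "((\<lambda>s. apply_bcontfun (J s) x) has_vector_derivative Dx (b s) (x + u s x) o\<^sub>L J s x) (at s within {0..T})"
    if s: "s \<in> {0..T}" for s x
    using bounded_linear.has_vector_derivative[OF bounded_linear_apply_bcontfun J[OF s], of x]
    by (simp add: apply_comp_deriv[OF b(1)[OF s]])
qed (use init t in auto)

context current_flow
begin

lemma trajectory_solution:
  assumes w: "trajectory T M w"
  shows "is_solution B \<xi>0 T (\<lambda>t. cur (w t))"
proof -
  define \<phi> where "\<phi> t x = x + apply_bcontfun (fst (w t)) x" for t x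
  have deriv: "(w has_vector_derivative velocity (w t)) (at t within {0..T})"
    and M: "norm (snd (w t)) \<le> M" if "t \<in> {0..T}" for t
    using w that by (auto simp: trajectory_def)
  have init: "fst (w 0) = 0" "snd (w 0) = const_bcontfun id_blinfun"
    using w by (auto simp: trajectory_def w0_def)
  have u: "((\<lambda>t. fst (w t)) has_vector_derivative comp_field (B (cur (w t))) (fst (w t))) (at t within {0..T})"
    and J: "((\<lambda>t. snd (w t)) has_vector_derivative comp_deriv (B (cur (w t))) (fst (w t)) (snd (w t))) (at t within {0..T})"
    if "t \<in> {0..T}" for t
    using bounded_linear.has_vector_derivative[OF bounded_linear_fst deriv[OF that]]
      bounded_linear.has_vector_derivative[OF bounded_linear_snd deriv[OF that]]
    by (simp_all add: velocity_def)
  have "is_flow B (\<lambda>t. cur (w t)) T \<phi>"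
    using displacement_flow[of T "\<lambda>t. B (cur (w t))" "\<lambda>t. fst (w t)", OF C2b_B[OF cur_Mspace] u]
    by (auto simp: is_flow_def \<phi>_def init)
  moreover have "cur (w t) = push_current (\<phi> t) \<xi>0" if t: "t \<in> {0..T}" for t
  proof (rule push_current_eq_flow_current[symmetric])
    show "(\<phi> t has_derivative blinfun_apply (snd (w t) x)) (at x)" for x
      unfolding \<phi>_def
      by (rule displacement_flow_has_derivative[of T "\<lambda>t. B (cur (w t))", OF C2b_B[OF cur_Mspace] C2norm_B_cur u J init t])
        (rule M)
  qed (simp add: \<phi>_def)
  moreover have "\<exists>\<delta>>0. \<forall>s\<in>{0..T}. \<bar>s - t\<bar> < \<delta> \<longrightarrow> wnorm (\<lambda>\<theta>. cur (w s) \<theta> - cur (w t) \<theta>) < e"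
    if t: "t \<in> {0..T}" and e: "0 < e" for t e
  proof -
    \<comment> \<open>The Lipschitz constant from pairs to currents transfers norm continuity of
      \<open>w\<close> to weak continuity of the current.\<close>
    define C where "C = R * (1 + M)"
    have C: "0 \<le> C"
      using R_nonneg order_trans[OF norm_ge_zero M[OF t]] by (simp add: C_def)
    have "continuous_on {0..T} w"
      using deriv by (rule continuous_on_vector_derivative)
    then obtain \<delta> where \<delta>: "\<delta> > 0" "\<And>s. s \<in> {0..T} \<Longrightarrow> \<bar>s - t\<bar> < \<delta> \<Longrightarrow> norm (w s - w t) < e / (C + 1)"
      using C e t unfolding continuous_on_iff dist_norm real_norm_def
      by (metis add_nonneg_pos divide_pos_pos zero_less_one)
    have "wnorm (\<lambda>\<theta>. cur (w s) \<theta> - cur (w t) \<theta>) < e" if s: "s \<in> {0..T}" "\<bar>s - t\<bar> < \<delta>" for s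
    proof -
      have "wnorm (\<lambda>\<theta>. cur (w s) \<theta> - cur (w t) \<theta>) \<le> C * norm (w s - w t)"
        unfolding C_def by (rule wnorm_cur_diff_le[OF M[OF t]])
      also have "\<dots> \<le> C * (e / (C + 1))"
        using \<delta>(2)[OF s] C by (intro mult_left_mono) auto
      also have "\<dots> < e"
        using C e by (simp add: field_simps)
      finally show ?thesis .
    qed
    with \<delta>(1) show ?thesis
      by blast
  qed
  ultimately show ?thesis
    unfolding is_solution_def using cur_Mspace by blast
qed

text \<open>The field is frozen along the solution, the equations for \<open>u\<close> and then
  \<open>J\<close> are solved with it, and the given flow is identified with id + u. Neither bounded
  displacement nor differentiability of that flow is assumed; both come out of the
  construction.\<close>

lemma solution_trajectory:
  assumes \<eta>: "is_solution B \<xi>0 T \<eta>" and T: "0 \<le> T"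
  obtains w M where "trajectory T M w" "\<And>t. t \<in> {0..T} \<Longrightarrow> \<eta> t = cur (w t)"
proof -
  have \<eta>M: "\<eta> t \<in> Mspace" if "t \<in> {0..T}" for t
    using \<eta> that by (simp add: is_solution_def)
  obtain \<phi> where \<phi>: "is_flow B \<eta> T \<phi>" "\<And>t. t \<in> {0..T} \<Longrightarrow> \<eta> t = push_current (\<phi> t) \<xi>0"
    using \<eta> by (auto simp: is_solution_def)
  have wcont: "((\<lambda>s. wnorm (\<lambda>\<theta>. \<eta> s \<theta> - \<eta> t \<theta>)) \<longlongrightarrow> 0) (at t within {0..T})" if t: "t \<in> {0..T}" for t
  proof (rule tendstoI)
    fix e :: real assume "0 < e"
    then obtain \<delta> where "\<delta> > 0" "\<forall>s\<in>{0..T}. \<bar>s - t\<bar> < \<delta> \<longrightarrow> wnorm (\<lambda>\<theta>. \<eta> s \<theta> - \<eta> t \<theta>) < e"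
      using \<eta> t unfolding is_solution_def by blast
    then show "\<forall>\<^sub>F s in at t within {0..T}. dist (wnorm (\<lambda>\<theta>. \<eta> s \<theta> - \<eta> t \<theta>)) 0 < e"
      using wnorm_nonneg[OF Mspace_minus[OF \<eta>M \<eta>M[OF t]]]
      unfolding eventually_at by (intro exI[of _ \<delta>]) (auto simp: dist_real_def)
  qed
  \<comment> \<open>A solution carries no a priori bound. Compactness supplies one that may depend
    on the solution, which uniqueness tolerates.\<close>
  have "continuous_on {0..T} (\<lambda>t. wnorm (\<eta> t))"
    unfolding continuous_on_def
  proof
    fix t assume t: "t \<in> {0..T}"
    have "((\<lambda>s. wnorm (\<eta> s) - wnorm (\<eta> t)) \<longlongrightarrow> 0) (at t within {0..T})"
    proof (rule Lim_null_comparison[OF _ wcont[OF t]])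
      have "norm (wnorm (\<eta> s) - wnorm (\<eta> t)) \<le> wnorm (\<lambda>\<theta>. \<eta> s \<theta> - \<eta> t \<theta>)" if s: "s \<in> {0..T}" for s
        using wnorm_triangle_sub[OF \<eta>M[OF s] \<eta>M[OF t]] wnorm_triangle_sub[OF \<eta>M[OF t] \<eta>M[OF s]]
          wnorm_minus_commute[OF \<eta>M[OF s] \<eta>M[OF t]]
        by (simp add: abs_le_iff)
      then show "\<forall>\<^sub>F s in at t within {0..T}. norm (wnorm (\<eta> s) - wnorm (\<eta> t)) \<le> wnorm (\<lambda>\<theta>. \<eta> s \<theta> - \<eta> t \<theta>)"
        by (simp add: eventually_at_filter)
    qed
    then show "((\<lambda>s. wnorm (\<eta> s)) \<longlongrightarrow> wnorm (\<eta> t)) (at t within {0..T})"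
      by (rule LIM_zero_cancel)
  qed
  then have "bounded ((\<lambda>t. wnorm (\<eta> t)) ` {0..T})"
    by (intro compact_imp_bounded compact_continuous_image compact_Icc)
  then obtain N where N: "\<And>t. t \<in> {0..T} \<Longrightarrow> wnorm (\<eta> t) \<le> N"
    unfolding bounded_iff real_norm_def by (meson abs_le_D1 imageI)
  define K where "K = CB * (N + 1)"
  define b where "b t = B (\<eta> t)" for t
  have b: "C2b (b t)" if "t \<in> {0..T}" for t
    using that by (simp add: b_def C2b_B \<eta>M)
  have bK: "C2norm (b t) \<le> K" if "t \<in> {0..T}" for t
    unfolding K_def b_def using CB_pos N[OF that]
    by (intro order_trans[OF C2norm_B[OF \<eta>M[OF that]]] mult_left_mono) auto
  have K: "0 \<le> K"
    using C2norm_bound_nonneg[OF b bK, of 0] T by simp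
  define \<delta> where "\<delta> s t = CB * wnorm (\<lambda>\<theta>. \<eta> s \<theta> - \<eta> t \<theta>)" for s t
  have diff: "norm (b s x - b t x) \<le> \<delta> s t" "norm (Dx (b s) x - Dx (b t) x) \<le> \<delta> s t"
    if "s \<in> {0..T}" "t \<in> {0..T}" for s t x
    using that by (auto simp: b_def \<delta>_def intro!: B_diff_le \<eta>M)
  have \<delta>: "((\<lambda>s. \<delta> s t) \<longlongrightarrow> 0) (at t within {0..T})" if "t \<in> {0..T}" for t
    unfolding \<delta>_def using tendsto_mult_left[OF wcont[OF that], of CB] by simp

  obtain u where u: "u 0 = 0"
    "\<And>t. t \<in> {0..T} \<Longrightarrow> (u has_vector_derivative comp_field (b t) (u t)) (at t within {0..T})"
  proof (rule ode_exists[of T UNIV 0 K "\<lambda>t. comp_field (b t)"])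
    show "K-lipschitz_on UNIV (comp_field (b t))" if t: "t \<in> {0..T}" for t
      using norm_comp_field_diff_le[OF b[OF t] b[OF t] bK[OF t], of 0] K
      by (intro lipschitz_onI) (auto simp: dist_norm)
    show "continuous_on {0..T} (\<lambda>t. comp_field (b t) v)" for v
      unfolding continuous_on_def
    proof
      fix t assume t: "t \<in> {0..T}"
      have "norm (comp_field (b s) v - comp_field (b t) v) \<le> \<delta> s t" if s: "s \<in> {0..T}" for s
        using norm_comp_field_diff_le[OF b[OF s] b[OF t] bK[OF t] diff(1)[OF s t], of v v] by simp
      then have "((\<lambda>s. comp_field (b s) v - comp_field (b t) v) \<longlongrightarrow> 0) (at t within {0..T})"
        by (intro Lim_null_comparison[OF _ \<delta>[OF t]]) (simp add: eventually_at_filter)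
      then show "((\<lambda>s. comp_field (b s) v) \<longlongrightarrow> comp_field (b t) v) (at t within {0..T})"
        by (rule LIM_zero_cancel)
    qed
  qed (use T in auto)
  have u_cont: "(u \<longlongrightarrow> u t) (at t within {0..T})" if "t \<in> {0..T}" for t
    using continuous_on_vector_derivative[OF u(2)] that by (auto simp: continuous_on_def)

  \<comment> \<open>With \<open>u\<close> known, the equation is linear in \<open>J\<close>, with
    operator bound \<open>K\<close>.\<close>
  obtain J where J: "J 0 = const_bcontfun id_blinfun"
    "\<And>t. t \<in> {0..T} \<Longrightarrow> (J has_vector_derivative comp_deriv (b t) (u t) (J t)) (at t within {0..T})"
  proof (rule ode_exists[of T UNIV "const_bcontfun id_blinfun" K "\<lambda>t. comp_deriv (b t) (u t)"])
    show "K-lipschitz_on UNIV (comp_deriv (b t) (u t))" if t: "t \<in> {0..T}" for t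
      using norm_comp_deriv_diff_le[OF b[OF t] b[OF t] bK[OF t], of 0 "u t" _ "u t"] K
      by (intro lipschitz_onI) (auto simp: dist_norm)
    show "continuous_on {0..T} (\<lambda>t. comp_deriv (b t) (u t) F)" for F
      unfolding continuous_on_def
    proof
      fix t assume t: "t \<in> {0..T}"
      have "((\<lambda>s. comp_deriv (b s) (u s) F - comp_deriv (b t) (u t) F) \<longlongrightarrow> 0) (at t within {0..T})"
      proof (rule Lim_null_comparison)
        have "norm (comp_deriv (b s) (u s) F - comp_deriv (b t) (u t) F)
            \<le> (\<delta> s t + K * norm (u s - u t)) * norm F" if s: "s \<in> {0..T}" for s
          using norm_comp_deriv_diff_le[OF b[OF s] b[OF t] bK[OF t] diff(2)[OF s t], of "u s" F "u t" F] by simp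
        then show "\<forall>\<^sub>F s in at t within {0..T}. norm (comp_deriv (b s) (u s) F - comp_deriv (b t) (u t) F)
            \<le> (\<delta> s t + K * norm (u s - u t)) * norm F"
          by (simp add: eventually_at_filter)
        show "((\<lambda>s. (\<delta> s t + K * norm (u s - u t)) * norm F) \<longlongrightarrow> 0) (at t within {0..T})"
          by (auto intro!: tendsto_eq_intros \<delta>[OF t] u_cont[OF t])
      qed
      then show "((\<lambda>s. comp_deriv (b s) (u s) F) \<longlongrightarrow> comp_deriv (b t) (u t) F) (at t within {0..T})"
        by (rule LIM_zero_cancel)
    qed
  qed (use T in auto)

  \<comment> \<open>Uniqueness is applied at each point x separately, since the given flow is only
    known pointwise.\<close>
  have \<phi>_eq: "\<phi> t x = x + apply_bcontfun (u t) x" if t: "t \<in> {0..T}" for t x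
  proof (rule ode_unique[where T = T and L = K and v' = "\<lambda>t. b t (\<phi> t x)"
        and w' = "\<lambda>t. b t (x + apply_bcontfun (u t) x)"])
    show "((\<lambda>t. \<phi> t x) has_vector_derivative b s (\<phi> s x)) (at s within {0..T})" if "s \<in> {0..T}" for s
      using \<phi>(1) that by (simp add: is_flow_def b_def)
    show "((\<lambda>t. x + apply_bcontfun (u t) x) has_vector_derivative b s (x + u s x)) (at s within {0..T})"
      if "s \<in> {0..T}" for s
      by (rule displacement_flow[OF b u(2) that])
    show "norm (b s (\<phi> s x) - b s (x + u s x)) \<le> K * norm (\<phi> s x - (x + u s x))" if "s \<in> {0..T}" for s
      by (rule C2b_lipschitz[OF b[OF that] bK[OF that]])
  qed (use \<phi>(1) u(1) K t in \<open>auto simp: is_flow_def\<close>)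
  have \<eta>_eq: "\<eta> t = cur (u t, J t)" if t: "t \<in> {0..T}" for t
    unfolding \<phi>(2)[OF t]
  proof (rule push_current_eq_flow_current)
    have "\<phi> t = (\<lambda>x. x + apply_bcontfun (u t) x)"
      using \<phi>_eq[OF t] by auto
    then show "(\<phi> t has_derivative blinfun_apply (snd (u t, J t) x)) (at x)" for x
      using displacement_flow_has_derivative[OF b bK u(2) J(2) u(1) J(1) t] by simp
  qed (simp add: \<phi>_eq[OF t])

  have "continuous_on {0..T} J"
    using J(2) by (rule continuous_on_vector_derivative)
  then have "bounded (J ` {0..T})"
    by (intro compact_imp_bounded compact_continuous_image compact_Icc)
  then obtain M where "\<And>t. t \<in> {0..T} \<Longrightarrow> norm (J t) \<le> M"
    unfolding bounded_iff by (meson imageI)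
  then have "trajectory T M (\<lambda>t. (u t, J t))"
    using u J \<eta>_eq
    by (auto simp: trajectory_def w0_def velocity_def b_def intro!: has_vector_derivative_Pair)
  then show thesis
    using \<eta>_eq by (rule that)
qed

end

text \<open>Choosing T before \<open>\<xi>0\<close> expresses that, for the given \<open>B\<close>,
  it depends only on a bound for the norm. Uniqueness is equality as functionals, which is stronger
  than vanishing weak distance.\<close>

theorem theorem3p4:
  fixes B :: "('a::euclidean_space) current \<Rightarrow> 'a field" and CB :: real
  assumes "standing_assumptions B CB"
  shows "\<forall>R>0. \<exists>T>0. \<forall>\<xi>0\<in>Mspace. Mnorm \<xi>0 \<le> R \<longrightarrow>
           (\<exists>\<xi>. is_solution B \<xi>0 T \<xi> \<and>
              (\<forall>\<eta>. is_solution B \<xi>0 T \<eta> \<longrightarrow> (\<forall>t\<in>{0..T}. \<eta> t = \<xi> t)))"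
proof (intro allI impI)
  fix R :: real assume R: "0 < R"
  \<comment> \<open>The largest time allowed by \<open>trajectory_exists\<close>: 3
    \<open>field_bound 2\<close> T = 1.\<close>
  define T where "T = 1 / (3 * (CB * (R * 2 + 1)))"
  have "0 < CB"
    using assms by (simp add: standing_assumptions_def)
  with R have pos: "0 < CB * (R * 2 + 1)"
    by simp
  then have T: "0 < T" "3 * (CB * (R * 2 + 1)) * T \<le> 1"
    by (simp_all add: T_def)
  have "\<exists>\<xi>. is_solution B \<xi>0 T \<xi> \<and> (\<forall>\<eta>. is_solution B \<xi>0 T \<eta> \<longrightarrow> (\<forall>t\<in>{0..T}. \<eta> t = \<xi> t))"
    if "\<xi>0 \<in> Mspace" "Mnorm \<xi>0 \<le> R" for \<xi>0
  proof -
    interpret current_flow B CB \<xi>0 R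
      using assms that by unfold_locales
    obtain w where w: "trajectory T 2 w"
      using trajectory_exists[of T] T unfolding field_bound_def by force
    have "\<eta> t = cur (w t)" if \<eta>: "is_solution B \<xi>0 T \<eta>" and t: "t \<in> {0..T}" for \<eta> t
    proof -
      obtain v M where "trajectory T M v" "\<And>t. t \<in> {0..T} \<Longrightarrow> \<eta> t = cur (v t)"
        using solution_trajectory[OF \<eta> less_imp_le[OF T(1)]] by blast
      then show ?thesis
        using trajectory_unique[OF _ w t] t by auto
    qed
    then show ?thesis
      using trajectory_solution[OF w] by blast
  qed
  then show "\<exists>T>0. \<forall>\<xi>0\<in>Mspace. Mnorm \<xi>0 \<le> R \<longrightarrow> (\<exists>\<xi>. is_solution B \<xi>0 T \<xi> \<and>
      (\<forall>\<eta>. is_solution B \<xi>0 T \<eta> \<longrightarrow> (\<forall>t\<in>{0..T}. \<eta> t = \<xi> t)))"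
    using T(1) by blast
qed

end
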